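(* Let $\mathbb{K}\in\{\mathbb{R},\mathbb{C},\mathbb{H}\}$ and let $F$ be a $\mathbb{K}$-invariant Gårding–Dirichlet polynomial of degree $N$ on the space $\mathcal{S}_{\mathbb{K}}$ of $n\times n$ $\mathbb{K}$-Hermitian symmetric matrices. Then for every positive definite $A\in\mathcal{S}_{\mathbb{K}}$, $$F(A)^{1/N}\ \ge\ F(I)^{1/N}\,\det\nolimits_{\mathbb{K}}(A)^{1/n},$$ where $\det_{\mathbb{K}}(A)=\lambda_1(A)\cdots\lambda_n(A)$ is the product of the $n$ ($\mathbb K$-)eigenvalues of $A$.
   Context: $\mathcal S_{\mathbb R}=\mathrm{Sym}^2(\mathbb{R}^n)$ (real symmetric matrices), $\mathcal S_{\mathbb C}$ = Hermitian symmetric complex $n\times n$ matrices, $\mathcal S_{\mathbb H}$ = quaternionic Hermitian $n\times n$ matrices (equivalently, real symmetric $4n\times 4n$ matrices commuting with complex structures $I,J,K$ on $\mathbb{R}^{4n}$ satisfying the quaternion relations). Each $A\in\mathcal S_{\mathbb K}$ has $n$ real eigenvalues $\lambda_1(A),\dots,\lambda_n(A)$ counted with $\mathbb{K}$-multiplicity (in the quaternionic case each real eigenvalue of the $4n\times4n$ matrix of multiplicity $4m$ is listed $m$ times). A Gårding–Dirichlet polynomial of degree $N$ on $\mathcal S_{\mathbb K}$ is a real-valued homogeneous polynomial $F$ of degree $N$ with $F(I)>0$ such that $t\mapsto F(tI+A)$ has only real roots for every $A$ and whose Gårding cone (connected component of $\{F\ne0\}$ containing $I$) contains all positive definite $A$.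 $F$ is $\mathbb{K}$-invariant if $F(gAg^{*})=F(A)$ for all $g$ in $O(n)$, $U(n)$, or $Sp(n)\cdot Sp(1)$ respectively. *)

theory Defs
  imports "HOL-Analysis.Analysis" "HOL-Computational_Algebra.Polynomial"
begin

text \<open>All three spaces S_K are realised as real symmetric m x m matrices commuting
  with a list of complex structures: none (K = R), one J (K = C, m = 2n),
  or I, J, K with the quaternion relations (K = H, m = 4n).\<close>

definition sym_space :: "(real^'m^'m) list \<Rightarrow> (real^'m::finite^'m) set" where
  "sym_space Js = {A. transpose A = A \<and> (\<forall>X\<in>set Js. A ** X = X ** A)}"

definition complex_structure :: "real^'m^'m::finite \<Rightarrow> bool" where
  "complex_structure X \<longleftrightarrow> orthogonal_matrix X \<and> X ** X = - mat 1"

definition quaternionic_structure ::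
  "real^'m^'m::finite \<Rightarrow> real^'m^'m \<Rightarrow> real^'m^'m \<Rightarrow> bool" where
  "quaternionic_structure I J K \<longleftrightarrow>
     complex_structure I \<and> complex_structure J \<and> complex_structure K \<and> I ** J = K"

definition pos_def :: "real^'m^'m::finite \<Rightarrow> bool" where
  "pos_def A \<longleftrightarrow> (\<forall>x. x \<noteq> 0 \<longrightarrow> x \<bullet> (A *v x) > 0)"

definition hom_poly_on :: "'a::real_vector set \<Rightarrow> nat \<Rightarrow> ('a \<Rightarrow> real) \<Rightarrow> bool" where
  "hom_poly_on S N F \<longleftrightarrow>
     (\<exists>(k::nat) (l :: nat \<Rightarrow> nat \<Rightarrow> 'a \<Rightarrow> real).
        (\<forall>i j. linear (l i j)) \<and> (\<forall>x\<in>S. F x = (\<Sum>i<k. \<Prod>j<N. l i j x)))"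

definition garding_cone :: "(real^'m^'m::finite) set \<Rightarrow> (real^'m^'m \<Rightarrow> real) \<Rightarrow> (real^'m^'m) set" where
  "garding_cone S F = connected_component_set (S \<inter> {A. F A \<noteq> 0}) (mat 1)"

definition garding_dirichlet :: "(real^'m^'m::finite) set \<Rightarrow> nat \<Rightarrow> (real^'m^'m \<Rightarrow> real) \<Rightarrow> bool" where
  "garding_dirichlet S N F \<longleftrightarrow>
     hom_poly_on S N F \<and> F (mat 1) > 0 \<and>
     (\<forall>A\<in>S. \<exists>p :: real poly. (\<forall>t. poly p t = F (t *\<^sub>R mat 1 + A)) \<and>
                  (\<forall>z. poly (map_poly complex_of_real p) z = 0 \<longrightarrow> z \<in> \<real>)) \<and>
     (\<forall>A\<in>S. pos_def A \<longrightarrow> A \<in> garding_cone S F)"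

definition invariant_under :: "(real^'m^'m::finite) set \<Rightarrow> (real^'m^'m) set \<Rightarrow> (real^'m^'m \<Rightarrow> real) \<Rightarrow> bool" where
  "invariant_under G S F \<longleftrightarrow> (\<forall>g\<in>G. \<forall>A\<in>S. F (g ** A ** transpose g) = F A)"

definition unitary_group :: "real^'m^'m::finite \<Rightarrow> (real^'m^'m) set" where
  "unitary_group J = {g. orthogonal_matrix g \<and> g ** J = J ** g}"

definition sp_sp1_group :: "real^'m^'m::finite \<Rightarrow> real^'m^'m \<Rightarrow> real^'m^'m \<Rightarrow> (real^'m^'m) set" where
  "sp_sp1_group I J K =
     {a ** (q0 *\<^sub>R mat 1 + q1 *\<^sub>R I + q2 *\<^sub>R J + q3 *\<^sub>R K) | a q0 q1 q2 q3.
        orthogonal_matrix a \<and> a ** I = I ** a \<and> a ** J = J ** a \<and> a ** K = K ** a \<and>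
        q0\<^sup>2 + q1\<^sup>2 + q2\<^sup>2 + q3\<^sup>2 = 1}"

text \<open>det_K: product of the K-eigenvalues; a real eigenvalue of (real) multiplicity d
  (= dimension of its eigenspace, A symmetric) is listed d/k times, k = dim_R K.\<close>
definition Kdet :: "nat \<Rightarrow> real^'m^'m::finite \<Rightarrow> real" where
  "Kdet k A = (\<Prod>c\<in>{c. \<exists>x. x \<noteq> 0 \<and> A *v x = c *\<^sub>R x}.
                   c ^ (dim {x. A *v x = c *\<^sub>R x} div k))"

end

theory Submission
  imports Defs "HOL-Computational_Algebra.Fundamental_Theorem_Algebra" "HOL-Combinatorics.Permutations"
begin

text \<open>
  Write \<open>A = (\<Sum>v. x v *\<^sub>R P v)\<close> with \<open>P v\<close> the projections onto the lines of an eigenbasis over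
  the division algebra. Then \<open>F A\<close> is a homogeneous polynomial in the eigenvalues \<open>x\<close> whose coefficients are values
  of the polarization of \<open>F\<close> at positive semidefinite matrices. They are nonnegative: real-rootedness
  in the direction of the identity spreads to the whole positive cone, i.e. \<open>F (X + \<i> Y) \<noteq> 0\<close> for
  \<open>Y\<close> positive definite, and by Gauss--Lucas this survives differentiation in positive directions.
  By invariance all first derivatives \<open>\<partial>F/\<partial>x v\<close> at the identity agree, so a tangent line estimate
  \<open>exp u \<ge> 1 + u\<close> applied to each monomial (weighted AM-GM) gives the bound by the geometric mean.
\<close>

section \<open>Complex polynomials and the upper half plane\<close>

text \<open>Real-rootedness is given along the identity alone, whereas the coefficients to be
  controlled are mixed values at several projections. Complex arguments bridge this gap, since
  nonvanishing at \<open>X + \<i> Y\<close> passes to derivatives one direction at a time. To speak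
  of complex arguments at all, \<open>F\<close> is replaced by a sum of products of real linear
  functionals, each extended by hand to \<open>l x + \<i> l y\<close>. Equality of the first
  derivatives matters because each of them is the weighted count of one eigenvalue among the
  monomials. Equal counts make the weighted geometric mean of the monomials a power of the
  determinant.\<close>

lemma coeff_prod_linear:
  fixes a b :: "'j \<Rightarrow> 'c::comm_semiring_1"
  assumes "finite J"
  shows "degree (\<Prod>j\<in>J. [:a j, b j:]) \<le> card J \<and> coeff (\<Prod>j\<in>J. [:a j, b j:]) (card J) = (\<Prod>j\<in>J. b j)"
  using assms
proof (induction J rule: finite_induct)
  case empty
  then show ?case by simp
next
  case (insert x J)
  let ?q = "\<Prod>j\<in>J. [:a j, b j:]"
  have "degree ([:a x, b x:] * ?q) \<le> Suc (card J)"
    using degree_mult_le[of "[:a x, b x:]" ?q] insert.IH degree_pCons_le[of "a x" "[:b x:]"]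
    by simp
  moreover have "coeff ([:a x, b x:] * ?q) (Suc (card J)) = b x * (\<Prod>j\<in>J. b j)"
    using insert.IH by (simp add: coeff_eq_0)
  ultimately show ?case
    using insert by simp
qed

text \<open>The top coefficient can cancel in the sum, so the degree is only bounded here; where the
  exact degree matters, nonvanishing of the form supplies it.\<close>

lemma coeff_sum_prod_linear:
  fixes a b :: "'i \<Rightarrow> 'j \<Rightarrow> 'c::comm_ring_1"
  assumes "finite J"
  shows "degree (\<Sum>i\<in>I. smult (w i) (\<Prod>j\<in>J. [:a i j, b i j:])) \<le> card J"
    and "coeff (\<Sum>i\<in>I. smult (w i) (\<Prod>j\<in>J. [:a i j, b i j:])) (card J) = (\<Sum>i\<in>I. w i * (\<Prod>j\<in>J. b i j))"
proof -
  have "degree (smult (w i) (\<Prod>j\<in>J. [:a i j, b i j:])) \<le> card J" for i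
    using coeff_prod_linear[OF assms, of "a i" "b i"] degree_smult_le order_trans by blast
  then show "degree (\<Sum>i\<in>I. smult (w i) (\<Prod>j\<in>J. [:a i j, b i j:])) \<le> card J"
    by (cases "finite I") (auto intro: degree_sum_le)
  show "coeff (\<Sum>i\<in>I. smult (w i) (\<Prod>j\<in>J. [:a i j, b i j:])) (card J) = (\<Sum>i\<in>I. w i * (\<Prod>j\<in>J. b i j))"
    by (simp add: coeff_sum coeff_prod_linear[OF assms])
qed

lemma poly_sum_prod_linear:
  "poly (\<Sum>i\<in>I. smult (w i) (\<Prod>j\<in>J. [:a i j, b i j:])) t
    = (\<Sum>i\<in>I. w i * (\<Prod>j\<in>J. a i j + t * b i j))"
  for a b :: "'i \<Rightarrow> 'j \<Rightarrow> 'c::comm_ring_1"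
  by (simp add: poly_sum poly_prod)

text \<open>The product of the distances from \<open>t\<close> to the roots is the modulus of the value at \<open>t\<close>.\<close>

lemma exists_root_near:
  fixes q :: "complex poly"
  assumes "degree q > 0" and "\<delta> > 0" and small: "cmod (poly q t) < cmod (lead_coeff q) * \<delta> ^ degree q"
  obtains z where "poly q z = 0" "cmod (t - z) < \<delta>"
proof -
  obtain root where q: "smult (lead_coeff q) (\<Prod>i<degree q. [:-root i, 1:]) = q"
    using complex_poly_decompose' .
  have val: "poly q x = lead_coeff q * (\<Prod>i<degree q. x - root i)" for x
    by (subst q[symmetric]) (simp add: poly_prod)
  have "\<exists>i<degree q. cmod (t - root i) < \<delta>"
  proof (rule ccontr)
    assume "\<not> ?thesis"
    then have "\<delta> ^ degree q \<le> (\<Prod>i<degree q. cmod (t - root i))"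
      using prod_mono[of "{..<degree q}" "\<lambda>_. \<delta>" "\<lambda>i. cmod (t - root i)"] \<open>\<delta> > 0\<close> by force
    then have "cmod (lead_coeff q) * \<delta> ^ degree q \<le> cmod (poly q t)"
      unfolding val norm_mult prod_norm by (simp add: mult_left_mono)
    with small show False by simp
  qed
  then obtain i where "i < degree q" "cmod (t - root i) < \<delta>" by blast
  moreover from this have "poly q (root i) = 0"
    by (auto simp: val)
  ultimately show ?thesis using that by blast
qed

text \<open>As in the Gauss--Lucas theorem: \<open>q' / q\<close> at \<open>0\<close> is a sum of numbers in one open half plane.\<close>

lemma pderiv_nonzero_half_plane:
  fixes q :: "complex poly"
  assumes "degree q > 0" and nz: "\<And>t. Im t \<ge> 0 \<Longrightarrow> poly q t \<noteq> 0"
  shows "poly (pderiv q) 0 \<noteq> 0"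
proof -
  obtain root where q: "smult (lead_coeff q) (\<Prod>i<degree q. [:-root i, 1:]) = q"
    using complex_poly_decompose' .
  have val: "poly q x = lead_coeff q * (\<Prod>i<degree q. x - root i)" for x
    by (subst q[symmetric]) (simp add: poly_prod)
  have root: "Im (root i) < 0" if "i < degree q" for i
  proof (rule ccontr)
    assume "\<not> ?thesis"
    then have "poly q (root i) \<noteq> 0" by (intro nz) simp
    then show False using that by (auto simp: val)
  qed
  have "poly (pderiv q) 0 = lead_coeff q * (\<Sum>i<degree q. \<Prod>j\<in>{..<degree q}-{i}. - root j)"
    by (subst q[symmetric]) (simp add: pderiv_smult pderiv_prod poly_sum poly_prod pderiv_pCons)
  also have "\<dots> = lead_coeff q * (\<Sum>i<degree q. (\<Prod>j<degree q. - root j) / (- root i))"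
  proof (intro arg_cong2[where f = "(*)"] sum.cong refl)
    fix i assume i: "i \<in> {..<degree q}"
    then have "root i \<noteq> 0" using root[of i] by auto
    then show "(\<Prod>j\<in>{..<degree q}-{i}. - root j) = (\<Prod>j<degree q. - root j) / (- root i)"
      using i by (subst (2) prod.remove[of _ i]) auto
  qed
  also have "\<dots> = - poly q 0 * (\<Sum>i<degree q. 1 / root i)"
    by (simp add: val sum_distrib_left sum_negf mult.assoc)
  finally have eq: "poly (pderiv q) 0 = - poly q 0 * (\<Sum>i<degree q. 1 / root i)" .
  have "Im (\<Sum>i<degree q. 1 / root i) > 0"
    unfolding Im_sum
  proof (rule sum_pos)
    fix i assume "i \<in> {..<degree q}"
    then have "Im (root i) < 0" using root by auto
    then show "0 < Im (1 / root i)"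
      by (auto simp: Im_divide divide_simps sum_power2_gt_zero_iff)
  qed (use assms in auto)
  then have "(\<Sum>i<degree q. 1 / root i) \<noteq> 0" by (metis zero_complex.sel(2) less_irrefl)
  then show ?thesis using nz[of 0] by (simp add: eq)
qed

text \<open>Consider the least \<open>s\<close> for which a root lies in the closed upper half
  plane; it exists since \<open>R\<close> confines the roots to a compact set. That root is off the
  real axis, so by continuity a nearby root survives for a slightly smaller parameter, a
  contradiction.\<close>

lemma lower_half_plane_homotopy:
  fixes Q :: "real \<Rightarrow> complex poly"
  assumes deg: "\<And>s. s \<in> {0..1} \<Longrightarrow> degree (Q s) = N" and lead: "\<And>s. s \<in> {0..1} \<Longrightarrow> coeff (Q s) N = c"
    and cont: "continuous_on UNIV (\<lambda>(s, t). poly (Q s) t)"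
    and bd: "\<And>s t. s \<in> {0..1} \<Longrightarrow> poly (Q s) t = 0 \<Longrightarrow> cmod t \<le> R"
    and re: "\<And>s t. s \<in> {0..1} \<Longrightarrow> poly (Q s) (complex_of_real t) \<noteq> 0"
    and start: "\<And>t. Im t \<ge> 0 \<Longrightarrow> poly (Q 0) t \<noteq> 0"
    and t: "Im t \<ge> 0"
  shows "poly (Q 1) t \<noteq> 0"
proof
  assume root1: "poly (Q 1) t = 0"
  define E where "E = {(s, t). s \<in> {0..1} \<and> Im t \<ge> 0 \<and> poly (Q s) t = 0}"
  have "E = ({0..1} \<times> (cball 0 R \<inter> {t. Im t \<ge> 0})) \<inter> {p. (case p of (s, t) \<Rightarrow> poly (Q s) t) = 0}"
    using bd by (auto simp: E_def)
  moreover have "compact ({0..1::real} \<times> (cball (0::complex) R \<inter> {t. Im t \<ge> 0}))"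
    by (intro compact_Times compact_Int_closed compact_cball closed_halfspace_Im_ge) simp
  moreover have "closed {p. (case p of (s, t) \<Rightarrow> poly (Q s) t) = 0}"
    using cont by (intro closed_Collect_eq continuous_on_const) simp_all
  ultimately have "compact E"
    by (simp add: compact_Int_closed)
  then have "compact (fst ` E)"
    by (intro compact_continuous_image continuous_on_fst continuous_on_id)
  moreover have "1 \<in> fst ` E"
    using root1 t by (force simp: E_def)
  ultimately obtain s where s: "s \<in> fst ` E" and min: "\<And>s'. s' \<in> fst ` E \<Longrightarrow> s \<le> s'"
    using compact_attains_inf[of "fst ` E"] by blast
  then obtain z where z: "s \<in> {0..1}" "Im z \<ge> 0" "poly (Q s) z = 0"
    by (auto simp: E_def)
  have "s > 0" using start z by (cases "s = 0") auto
  have Imz: "Im z > 0"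
  proof (rule ccontr)
    assume "\<not> ?thesis"
    then have "z = complex_of_real (Re z)" using z by (simp add: complex_eq_iff)
    then show False using re[of s "Re z"] z by simp
  qed
  have "poly (Q s) \<noteq> (\<lambda>_. 0)" using re[of s 0] z by (metis)
  then have "Q s \<noteq> 0" by auto
  then have "c \<noteq> 0" using deg lead z by (metis leading_coeff_0_iff)
  have "N > 0"
  proof (rule ccontr)
    assume "\<not> ?thesis"
    then obtain a where "Q s = [:a:]" using deg z by (metis degree_eq_zeroE not_gr0)
    then show False using z re[of s 0] by simp
  qed
  \<comment> \<open>The threshold of \<open>exists_root_near\<close> for distance
    \<open>Im z\<close>: a root closer than that to \<open>z\<close> is still in the upper half
    plane. The fixed leading coefficient makes it the same for all parameters.\<close>
  define \<epsilon> where "\<epsilon> = cmod c * Im z ^ N"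
  have "\<epsilon> > 0" using \<open>c \<noteq> 0\<close> Imz by (simp add: \<epsilon>_def)
  have "continuous_on UNIV (\<lambda>s. poly (Q s) z)"
    using continuous_on_compose2[OF cont, of UNIV "\<lambda>s. (s, z)"] by (simp add: continuous_on_Pair)
  then obtain d where d: "d > 0" "\<And>s'. dist s' s < d \<Longrightarrow> dist (poly (Q s') z) (poly (Q s) z) < \<epsilon>"
    using \<open>\<epsilon> > 0\<close> unfolding continuous_on_iff by (metis UNIV_I)
  \<comment> \<open>Capping the decrement at \<open>s\<close> keeps the new parameter
    nonnegative.\<close>
  define s' where "s' = s - min s (d/2)"
  have s': "s' \<in> {0..1}" "s' < s" "dist s' s < d"
    using z \<open>s > 0\<close> d by (auto simp: s'_def dist_real_def)
  have "cmod (poly (Q s') z) < cmod (lead_coeff (Q s')) * Im z ^ degree (Q s')"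
    using d(2)[OF s'(3)] z deg[OF s'(1)] lead[OF s'(1)] by (simp add: \<epsilon>_def dist_norm)
  then obtain z' where z': "poly (Q s') z' = 0" "cmod (z - z') < Im z"
    using exists_root_near[of "Q s'" "Im z" z] deg[OF s'(1)] \<open>N > 0\<close> Imz by auto
  then have "Im z' \<ge> 0"
    using abs_Im_le_cmod[of "z - z'"] by auto
  then have "s' \<in> fst ` E"
    using z' s' by (force simp: E_def)
  then show False using min s' by fastforce
qed


section \<open>Hyperbolic forms and their polarization\<close>

text \<open>\<open>C\<close> models the positive definite cone and \<open>e\<close> the identity.
  \<open>C_open\<close> asks for room in the direction \<open>- e\<close>, which is what splitting
  off a multiple of \<open>e\<close> in \<open>stable\<close> uses.\<close>

locale hyperbolic_form =
  fixes S C :: "'a::real_vector set" and e :: 'a and k N :: nat and l :: "nat \<Rightarrow> nat \<Rightarrow> 'a \<Rightarrow> real"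
  assumes subspace_S: "subspace S"
    and lin: "\<And>i j. linear (l i j)"
    and C_subset: "C \<subseteq> S"
    and e_in_C: "e \<in> C"
    and C_add: "\<And>x y. x \<in> C \<Longrightarrow> y \<in> C \<Longrightarrow> x + y \<in> C"
    and C_scale: "\<And>c x. c > 0 \<Longrightarrow> x \<in> C \<Longrightarrow> c *\<^sub>R x \<in> C"
    and C_open: "\<And>x. x \<in> C \<Longrightarrow> \<exists>c>0. x - c *\<^sub>R e \<in> C"
    and form_e: "(\<Sum>i<k. \<Prod>j<N. l i j e) > 0"
    and nonzero: "\<And>x. x \<in> C \<Longrightarrow> (\<Sum>i<k. \<Prod>j<N. l i j x) \<noteq> 0"
    and real_rooted: "\<And>x z. x \<in> S \<Longrightarrow>
      (\<Sum>i<k. \<Prod>j<N. complex_of_real (l i j x) + z * complex_of_real (l i j e)) = 0 \<Longrightarrow> z \<in> \<real>"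
begin

lemmas l_simps = linear_add[OF lin] linear_diff[OF lin] linear_scale[OF lin] linear_0[OF lin]

text \<open>The roots \<open>t\<close> of \<open>F (s x + t y + \<i> c e)\<close> lie in the lower half plane for \<open>s = 0\<close>
  and cannot cross the real axis as \<open>s\<close> increases to \<open>1\<close>.\<close>

lemma stable:
  assumes x: "x \<in> S" and y: "y \<in> C"
  shows "(\<Sum>i<k. \<Prod>j<N. complex_of_real (l i j x) + \<i> * complex_of_real (l i j y)) \<noteq> 0"
proof -
  obtain c where c: "c > 0" and yc: "y - c *\<^sub>R e \<in> C"
    using C_open[OF y] by blast
  define y' where "y' = y - c *\<^sub>R e"
  have y': "y' \<in> C" using yc by (simp add: y'_def)
  \<comment> \<open>\<open>Q s\<close> at \<open>t\<close> is the form at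
    \<open>s x + t y' + \<i> c e\<close>. The part \<open>\<i> c e\<close> split off
    \<open>y\<close> keeps real \<open>t\<close> from being roots, and \<open>s = 1\<close>,
    \<open>t = \<i>\<close> gives the desired point \<open>x + \<i> y\<close>.\<close>
  define Q where "Q s = (\<Sum>i<k. smult 1 (\<Prod>j<N. [:complex_of_real (s * l i j x) + \<i> * complex_of_real (c * l i j e),
    complex_of_real (l i j y'):]))" for s
  have Q: "poly (Q s) t = (\<Sum>i<k. \<Prod>j<N. complex_of_real (s * l i j x) + \<i> * complex_of_real (c * l i j e)
      + t * complex_of_real (l i j y'))" for s t
    unfolding Q_def poly_sum_prod_linear by simp
  have coeff: "coeff (Q s) N = complex_of_real (\<Sum>i<k. \<Prod>j<N. l i j y')" for s
    using coeff_sum_prod_linear(2)[of "{..<N}" "\<lambda>_. 1" "\<lambda>i j. complex_of_real (s * l i j x) + \<i> * complex_of_real (c * l i j e)"]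
    by (simp add: Q_def)
  have deg: "degree (Q s) = N" for s
  proof (rule antisym)
    show "degree (Q s) \<le> N"
      unfolding Q_def by (rule order_trans[OF coeff_sum_prod_linear(1)]) simp_all
    show "N \<le> degree (Q s)"
      using coeff[of s] nonzero[OF y'] by (intro le_degree) (simp del: of_real_sum of_real_prod)
  qed
  have re: "poly (Q s) (complex_of_real t) \<noteq> 0" for s t
  proof
    assume "poly (Q s) (complex_of_real t) = 0"
    then have "(\<Sum>i<k. \<Prod>j<N. complex_of_real (l i j (s *\<^sub>R x + t *\<^sub>R y')) + (\<i> * complex_of_real c) * complex_of_real (l i j e)) = 0"
      unfolding Q by (simp add: l_simps algebra_simps)
    moreover have "s *\<^sub>R x + t *\<^sub>R y' \<in> S"
      using x y' C_subset subspace_S by (meson subsetD subspace_add subspace_scale)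
    ultimately have "\<i> * complex_of_real c \<in> \<real>"
      using real_rooted by blast
    then show False using c by (simp add: complex_is_Real_iff)
  qed
  have start: "poly (Q 0) t \<noteq> 0" if t: "Im t \<ge> 0" for t
  proof
    assume root: "poly (Q 0) t = 0"
    have "t \<noteq> 0" using re[of 0 0] root by auto
    \<comment> \<open>At \<open>s = 0\<close> homogeneity allows dividing by \<open>t\<close>, which
      leaves a zero at \<open>y' + (\<i> c / t) e\<close>. The ratio is then real, and positive when
      \<open>Im t \<ge> 0\<close>, so the form would vanish inside \<open>C\<close>.\<close>
    have "poly (Q 0) t = (\<Sum>i<k. \<Prod>j<N. t * (complex_of_real (l i j y') + (\<i> * c / t) * complex_of_real (l i j e)))"
      unfolding Q using \<open>t \<noteq> 0\<close> by (simp add: distrib_left add.commute mult.assoc)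
    also have "\<dots> = t ^ N * (\<Sum>i<k. \<Prod>j<N. complex_of_real (l i j y') + (\<i> * c / t) * complex_of_real (l i j e))"
      by (simp add: prod.distrib sum_distrib_left)
    finally have zero: "(\<Sum>i<k. \<Prod>j<N. complex_of_real (l i j y') + (\<i> * c / t) * complex_of_real (l i j e)) = 0"
      using root \<open>t \<noteq> 0\<close> by simp
    then have "\<i> * c / t \<in> \<real>"
      using real_rooted[OF _ zero] y' C_subset by auto
    then obtain r where r: "\<i> * c / t = complex_of_real r"
      by (auto elim: Reals_cases)
    then have "\<i> * c = complex_of_real r * t" using \<open>t \<noteq> 0\<close> by (simp add: field_simps)
    then have "Im (\<i> * c) = Im (complex_of_real r * t)" by (rule arg_cong)
    then have "c = r * Im t" by simp
    then have "r > 0" using c t by (metis mult_le_0_iff not_le)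
    then have "y' + r *\<^sub>R e \<in> C" by (simp add: C_add C_scale y' e_in_C)
    moreover have "complex_of_real (\<Sum>i<k. \<Prod>j<N. l i j (y' + r *\<^sub>R e)) = 0"
      using zero by (simp add: r l_simps)
    ultimately show False using nonzero by (simp del: of_real_sum of_real_prod)
  qed
  \<comment> \<open>The form with \<open>t\<close> divided out, as a function of
    \<open>v = s / t\<close> and \<open>u = 1 / t\<close>. At the origin it is the value at
    \<open>y'\<close>, hence nonzero nearby, so the roots are bounded uniformly in
    \<open>s\<close>.\<close>
  define h where "h = (\<lambda>(v, u). \<Sum>i<k. \<Prod>j<N. v * complex_of_real (l i j x) + \<i> * complex_of_real (c * l i j e) * u
      + complex_of_real (l i j y'))"
  have "h (0, 0) \<noteq> 0"
    using nonzero[OF y'] by (simp add: h_def flip: of_real_prod of_real_sum)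
  moreover have "continuous_on UNIV h"
    unfolding h_def split_beta by (intro continuous_intros)
  ultimately obtain d where d: "d > 0" "\<And>w. dist (0, 0) w < d \<Longrightarrow> h w \<noteq> 0"
    using continuous_on_open_avoid[of UNIV h "(0, 0)" 0] by auto
  have bd: "cmod t \<le> 2 / d" if s: "s \<in> {0..1}" and root: "poly (Q s) t = 0" for s t
  proof (rule ccontr)
    assume "\<not> ?thesis"
    then have t: "2 / d < cmod t" by simp
    moreover have "2 / d > 0" using d by simp
    ultimately have t0: "t \<noteq> 0" by auto
    have "poly (Q s) t = (\<Sum>i<k. \<Prod>j<N. t * ((s / t) * complex_of_real (l i j x) + \<i> * complex_of_real (c * l i j e) * (1 / t)
      + complex_of_real (l i j y')))"
      unfolding Q using t0 by (simp add: distrib_left)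
    also have "\<dots> = t ^ N * h (s / t, 1 / t)"
      by (simp add: h_def prod.distrib sum_distrib_left)
    finally have "h (s / t, 1 / t) = 0"
      using root t0 by simp
    moreover have "dist (0, 0) (complex_of_real s / t, 1 / t) < d"
    proof -
      have "norm (complex_of_real s / t, 1 / t) \<le> norm (complex_of_real s / t) + norm (1 / t)"
        by (simp add: norm_Pair_le)
      also have "\<dots> \<le> 1 / cmod t + 1 / cmod t"
        using s by (intro add_mono) (simp_all add: norm_divide divide_right_mono)
      also have "\<dots> < d"
        using t d(1) t0 by (simp add: pos_divide_less_eq mult.commute)
      finally show ?thesis
        by (simp add: dist_norm norm_Pair)
    qed
    ultimately show False using d by blast
  qed
  have "poly (Q 1) \<i> \<noteq> 0"
  proof (rule lower_half_plane_homotopy[where Q = Q and N = N and R = "2 / d"])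
    show "continuous_on UNIV (\<lambda>(s, t). poly (Q s) t)"
      unfolding Q split_beta by (intro continuous_intros)
  qed (use deg coeff re start bd in auto)
  moreover have "complex_of_real (1 * l i j x) + \<i> * complex_of_real (c * l i j e) + \<i> * complex_of_real (l i j y')
      = complex_of_real (l i j x) + \<i> * complex_of_real (l i j y)" for i j
    by (simp add: y'_def l_simps complex_eq_iff)
  ultimately show ?thesis
    unfolding Q by (simp only:) simp
qed

section \<open>Directional derivatives and polarization\<close>

text \<open>This is \<open>(N - r)!\<close> times the derivative of the form along
  \<open>B 0\<close>, ..., \<open>B (r - 1)\<close>, taken at \<open>x + \<i> y\<close>.\<close>

definition partial_polar :: "nat \<Rightarrow> (nat \<Rightarrow> 'a) \<Rightarrow> 'a \<Rightarrow> 'a \<Rightarrow> complex" where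
  "partial_polar r B x y = (\<Sum>i<k. \<Sum>\<sigma> | \<sigma> permutes {..<N}. (\<Prod>j<r. complex_of_real (l i (\<sigma> j) (B j))) *
      (\<Prod>j\<in>{r..<N}. complex_of_real (l i (\<sigma> j) x) + \<i> * complex_of_real (l i (\<sigma> j) y)))"

text \<open>\<open>fact N\<close> times the symmetric multilinear form that restricts to the given
  form on the diagonal.\<close>

definition polar :: "(nat \<Rightarrow> 'a) \<Rightarrow> real" where
  "polar B = (\<Sum>i<k. \<Sum>\<sigma> | \<sigma> permutes {..<N}. \<Prod>j<N. l i (\<sigma> j) (B j))"

lemma polar_diag: "polar (\<lambda>_. x) = fact N * (\<Sum>i<k. \<Prod>j<N. l i j x)"
proof -
  have "(\<Prod>j<N. l i (\<sigma> j) x) = (\<Prod>j<N. l i j x)" if "\<sigma> permutes {..<N}" for i \<sigma>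
    using prod.permute[OF that, of "\<lambda>j. l i j x"] by (simp add: o_def)
  then have "polar (\<lambda>_. x) = (\<Sum>i<k. \<Sum>\<sigma> | \<sigma> permutes {..<N}. \<Prod>j<N. l i j x)"
    unfolding polar_def by (intro sum.cong) auto
  also have "\<dots> = fact N * (\<Sum>i<k. \<Prod>j<N. l i j x)"
    by (simp add: card_permutations[of "{..<N}" N] sum_distrib_left)
  finally show ?thesis .
qed

text \<open>One direction is added at each step: as a polynomial in \<open>t\<close>, the value at
  \<open>x + \<i> y + t B r\<close> has no root with \<open>Im t \<ge> 0\<close>, because
  \<open>y + Im t B r\<close> stays in \<open>C\<close>. Hence its derivative at \<open>0\<close> is
  nonzero, and this is the next \<open>partial_polar\<close> up to a factor.\<close>

lemma partial_polar_nonzero: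
  assumes "r \<le> N" and "\<And>j. j < r \<Longrightarrow> B j \<in> C" and "x \<in> S" and "y \<in> C"
  shows "partial_polar r B x y \<noteq> 0"
  using assms
proof (induction r arbitrary: x y)
  case 0
  have "(\<Prod>j<N. complex_of_real (l i (\<sigma> j) x) + \<i> * complex_of_real (l i (\<sigma> j) y)) =
      (\<Prod>j<N. complex_of_real (l i j x) + \<i> * complex_of_real (l i j y))" if "\<sigma> permutes {..<N}" for i \<sigma>
    using prod.permute[OF that, of "\<lambda>j. complex_of_real (l i j x) + \<i> * complex_of_real (l i j y)"] by (simp add: o_def)
  then have "partial_polar 0 B x y = (\<Sum>i<k. \<Sum>\<sigma> | \<sigma> permutes {..<N}. \<Prod>j<N. complex_of_real (l i j x) + \<i> * complex_of_real (l i j y))"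
    unfolding partial_polar_def by (intro sum.cong) (auto simp: atLeast0LessThan)
  also have "\<dots> = fact N * (\<Sum>i<k. \<Prod>j<N. complex_of_real (l i j x) + \<i> * complex_of_real (l i j y))"
    by (simp add: card_permutations[of "{..<N}" N] sum_distrib_left)
  finally show ?case using stable[OF 0(3,4)] by simp
next
  case (Suc r)
  define P where "P = {..<k} \<times> {\<sigma>. \<sigma> permutes {..<N}}"
  define w where "w p = (\<Prod>j<r. complex_of_real (l (fst p) (snd p j) (B j)))" for p
  define a where "a p j = complex_of_real (l (fst p) (snd p j) x) + \<i> * complex_of_real (l (fst p) (snd p j) y)" for p :: "nat \<times> (nat \<Rightarrow> nat)" and j
  define b where "b p j = complex_of_real (l (fst p) (snd p j) (B r))" for p :: "nat \<times> (nat \<Rightarrow> nat)" and j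
  define Q where "Q = (\<Sum>p\<in>P. smult (w p) (\<Prod>j\<in>{r..<N}. [:a p j, b p j:]))"
  have B: "B r \<in> C" "B r \<in> S" using Suc.prems C_subset by auto
  have IH: "partial_polar r B x y \<noteq> 0" if "x \<in> S" "y \<in> C" for x y
    using Suc.IH[OF _ _ that] Suc.prems by simp
  have partial_polar: "partial_polar r B x y = (\<Sum>p\<in>P. w p * (\<Prod>j\<in>{r..<N}.
      complex_of_real (l (fst p) (snd p j) x) + \<i> * complex_of_real (l (fst p) (snd p j) y)))" for x y
    by (simp add: partial_polar_def P_def w_def sum.cartesian_product split_beta)
  have Q: "poly Q t \<noteq> 0" if t: "Im t \<ge> 0" for t
  proof -
    have "poly Q t = partial_polar r B (x + Re t *\<^sub>R B r) (y + Im t *\<^sub>R B r)"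
    proof -
      have "a p j + t * b p j = complex_of_real (l (fst p) (snd p j) (x + Re t *\<^sub>R B r)) +
          \<i> * complex_of_real (l (fst p) (snd p j) (y + Im t *\<^sub>R B r))" for p j
        by (simp add: a_def b_def l_simps complex_eq_iff)
      then show ?thesis
        unfolding Q_def poly_sum_prod_linear partial_polar by simp
    qed
    moreover have "x + Re t *\<^sub>R B r \<in> S"
      using Suc.prems B subspace_S by (meson subspace_add subspace_scale)
    moreover have "y + Im t *\<^sub>R B r \<in> C"
      using Suc.prems B t C_add C_scale by (cases "Im t = 0") auto
    ultimately show ?thesis using IH by simp
  qed
  \<comment> \<open>Up to a power of \<open>\<i>\<close>, the top coefficient is the value at the
    purely imaginary point \<open>\<i> B r\<close>, so the induction hypothesis covers it as
    well.\<close>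
  have "coeff Q (N - r) \<noteq> 0"
  proof -
    have "coeff Q (N - r) = (\<Sum>p\<in>P. w p * (\<Prod>j\<in>{r..<N}. b p j))"
      using coeff_sum_prod_linear(2)[of "{r..<N}" w a b P] by (simp add: Q_def)
    moreover have "partial_polar r B 0 (B r) = \<i> ^ (N - r) * (\<Sum>p\<in>P. w p * (\<Prod>j\<in>{r..<N}. b p j))"
      by (simp add: partial_polar l_simps prod.distrib sum_distrib_left b_def mult_ac)
    moreover have "partial_polar r B 0 (B r) \<noteq> 0"
      using IH B subspace_S subspace_0 by blast
    ultimately show ?thesis by auto
  qed
  then have "N - r \<le> degree Q" by (rule le_degree)
  then have "degree Q > 0" using Suc.prems by simp
  then have "poly (pderiv Q) 0 \<noteq> 0"
    using Q by (rule pderiv_nonzero_half_plane)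
  moreover have "poly (pderiv Q) 0 = of_nat (N - r) * partial_polar (Suc r) B x y"
  proof -
    have pderiv_sum: "pderiv (\<Sum>p\<in>P. f p) = (\<Sum>p\<in>P. pderiv (f p))" for f :: "_ \<Rightarrow> complex poly"
      by (induction P rule: infinite_finite_induct) (auto simp: pderiv_add)
    have "poly (pderiv Q) 0 = (\<Sum>p\<in>P. w p * (\<Sum>m\<in>{r..<N}. (\<Prod>j\<in>{r..<N}-{m}. a p j) * b p m))"
      by (simp add: Q_def pderiv_sum pderiv_smult pderiv_prod poly_sum poly_prod pderiv_pCons mult.commute)
    also have "\<dots> = (\<Sum>m\<in>{r..<N}. \<Sum>p\<in>P. w p * ((\<Prod>j\<in>{r..<N}-{m}. a p j) * b p m))"
      by (subst sum.swap) (simp add: sum_distrib_left)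
    also have "\<dots> = (\<Sum>m\<in>{r..<N}. partial_polar (Suc r) B x y)"
    proof (rule sum.cong[OF refl])
      fix m assume m: "m \<in> {r..<N}"
      \<comment> \<open>The derivative hits slot \<open>m\<close>. Reindexing the permutations by
        this swap moves \<open>B r\<close> to slot \<open>r\<close>, so all \<open>N - r\<close>
        terms agree.\<close>
      let ?\<tau> = "Transposition.transpose r m"
      have \<tau>: "?\<tau> permutes {..<N}"
        using m by (intro permutes_swap_id) auto
      have "(\<Sum>p\<in>P. w p * ((\<Prod>j\<in>{r..<N}-{m}. a p j) * b p m)) =
          (\<Sum>i<k. \<Sum>\<sigma> | \<sigma> permutes {..<N}. w (i, \<sigma>) * ((\<Prod>j\<in>{r..<N}-{m}. a (i, \<sigma>) j) * b (i, \<sigma>) m))"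
        by (simp add: P_def sum.cartesian_product split_beta)
      also have "\<dots> = (\<Sum>i<k. \<Sum>\<sigma> | \<sigma> permutes {..<N}. w (i, \<sigma> \<circ> ?\<tau>) *
          ((\<Prod>j\<in>{r..<N}-{m}. a (i, \<sigma> \<circ> ?\<tau>) j) * b (i, \<sigma> \<circ> ?\<tau>) m))"
        by (intro sum.cong refl sum_permutations_compose_right[OF \<tau>])
      also have "\<dots> = partial_polar (Suc r) B x y"
        unfolding partial_polar_def
      proof (intro sum.cong refl)
        fix i \<sigma>
        have "w (i, \<sigma> \<circ> ?\<tau>) = (\<Prod>j<r. complex_of_real (l i (\<sigma> j) (B j)))"
          unfolding w_def using m by (intro prod.cong) (auto simp: Transposition.transpose_def)
        moreover have "(\<Prod>j\<in>{r..<N}-{m}. a (i, \<sigma> \<circ> ?\<tau>) j) = (\<Prod>j\<in>{Suc r..<N}.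
            complex_of_real (l i (\<sigma> j) x) + \<i> * complex_of_real (l i (\<sigma> j) y))"
          by (rule prod.reindex_bij_witness[where i = ?\<tau> and j = ?\<tau>])
            (use m in \<open>auto simp: a_def Transposition.transpose_def\<close>)
        moreover have "b (i, \<sigma> \<circ> ?\<tau>) m = complex_of_real (l i (\<sigma> r) (B r))"
          by (simp add: b_def)
        ultimately show "w (i, \<sigma> \<circ> ?\<tau>) * ((\<Prod>j\<in>{r..<N}-{m}. a (i, \<sigma> \<circ> ?\<tau>) j) * b (i, \<sigma> \<circ> ?\<tau>) m) =
          (\<Prod>j<Suc r. complex_of_real (l i (\<sigma> j) (B j))) *
            (\<Prod>j\<in>{Suc r..<N}. complex_of_real (l i (\<sigma> j) x) + \<i> * complex_of_real (l i (\<sigma> j) y))"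
          by simp
      qed
      finally show "(\<Sum>p\<in>P. w p * ((\<Prod>j\<in>{r..<N}-{m}. a p j) * b p m)) = partial_polar (Suc r) B x y" .
    qed
    also have "\<dots> = of_nat (N - r) * partial_polar (Suc r) B x y"
      by simp
    finally show ?thesis .
  qed
  ultimately show ?case by auto
qed

lemma polar_nonzero:
  assumes "\<And>j. j < N \<Longrightarrow> B j \<in> C"
  shows "polar B \<noteq> 0"
proof -
  have "partial_polar N B e e = complex_of_real (polar B)"
    by (simp add: partial_polar_def polar_def)
  moreover have "partial_polar N B e e \<noteq> 0"
    using assms e_in_C C_subset by (intro partial_polar_nonzero) auto
  ultimately show ?thesis by auto
qed

text \<open>All arguments move along segments from \<open>e\<close> to \<open>B j\<close>; these
  stay in \<open>C\<close>, so the value never vanishes and keeps the sign it has at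
  \<open>e\<close>.\<close>

lemma polar_pos:
  assumes B: "\<And>j. j < N \<Longrightarrow> B j \<in> C"
  shows "polar B > 0"
proof (rule ccontr)
  assume neg: "\<not> ?thesis"
  define g where "g s = polar (\<lambda>j. (1 - s) *\<^sub>R e + s *\<^sub>R B j)" for s
  have "g 0 > 0" using form_e by (simp add: g_def polar_diag)
  moreover have "g 1 \<le> 0" using neg by (simp add: g_def)
  moreover have "continuous_on {0..1} g"
    unfolding g_def polar_def l_simps by (intro continuous_intros)
  ultimately obtain s where s: "0 \<le> s" "s \<le> 1" "g s = 0"
    using IVT2'[of g 1 0 0] by force
  have "(1 - s) *\<^sub>R e + s *\<^sub>R B j \<in> C" if "j < N" for j
  proof -
    \<comment> \<open>\<open>C_scale\<close> needs a positive factor, so the two ends are treated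
      apart.\<close>
    consider "s = 0" | "s = 1" | "0 < s" "s < 1" using s by linarith
    then show ?thesis using B[OF that] e_in_C by cases (auto intro!: C_add C_scale)
  qed
  then have "g s \<noteq> 0" unfolding g_def by (rule polar_nonzero)
  then show False using s by simp
qed

text \<open>Meant for boundary points of \<open>C\<close>, such as projections onto eigenlines: they
  are pushed inside by \<open>c e\<close>, and then \<open>c\<close> tends to
  \<open>0\<close>.\<close>

lemma polar_nonneg:
  assumes B: "\<And>j c. j < N \<Longrightarrow> c > 0 \<Longrightarrow> B j + c *\<^sub>R e \<in> C"
  shows "polar B \<ge> 0"
proof -
  define g where "g c = polar (\<lambda>j. B j + c *\<^sub>R e)" for c
  have "isCont g 0"
    unfolding g_def polar_def l_simps by (intro continuous_intros)
  then have "(g \<longlongrightarrow> g 0) (at_right 0)"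
    by (auto simp: isCont_def intro: filterlim_mono[OF _ _ at_le])
  moreover have "eventually (\<lambda>c. 0 \<le> g c) (at_right 0)"
    using eventually_at_right_less[of "0::real"]
    by eventually_elim (auto simp: g_def intro!: less_imp_le polar_pos B)
  ultimately have "0 \<le> g 0"
    by (intro tendsto_lowerbound) auto
  then show ?thesis by (simp add: g_def)
qed

section \<open>Monomial expansion and the geometric mean\<close>

text \<open>Monomials are indexed by ordered tuples \<open>f\<close>, with repetitions, so each
  coefficient is a single value of \<open>polar\<close> and no multinomial factors arise.\<close>

lemma form_expansion:
  assumes "finite V"
  shows "fact N * (\<Sum>i<k. \<Prod>j<N. l i j (\<Sum>v\<in>V. x v *\<^sub>R P v)) =
    (\<Sum>f \<in> PiE {..<N} (\<lambda>_. V). polar (\<lambda>j. P (f j)) * (\<Prod>j<N. x (f j)))"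
proof -
  have "fact N * (\<Sum>i<k. \<Prod>j<N. l i j (\<Sum>v\<in>V. x v *\<^sub>R P v)) =
    (\<Sum>i<k. \<Sum>\<sigma> | \<sigma> permutes {..<N}. \<Prod>j<N. \<Sum>v\<in>V. x v * l i (\<sigma> j) (P v))"
    unfolding polar_diag[symmetric] polar_def by (simp add: linear_sum[OF lin] l_simps)
  also have "\<dots> = (\<Sum>i<k. \<Sum>\<sigma> | \<sigma> permutes {..<N}. \<Sum>f \<in> PiE {..<N} (\<lambda>_. V).
      (\<Prod>j<N. l i (\<sigma> j) (P (f j))) * (\<Prod>j<N. x (f j)))"
    using assms by (simp add: prod_sum_PiE prod.distrib mult.commute)
  also have "\<dots> = (\<Sum>i<k. \<Sum>f \<in> PiE {..<N} (\<lambda>_. V). \<Sum>\<sigma> | \<sigma> permutes {..<N}.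
      (\<Prod>j<N. l i (\<sigma> j) (P (f j))) * (\<Prod>j<N. x (f j)))"
    by (intro sum.cong refl sum.swap)
  also have "\<dots> = (\<Sum>f \<in> PiE {..<N} (\<lambda>_. V). \<Sum>i<k. \<Sum>\<sigma> | \<sigma> permutes {..<N}.
      (\<Prod>j<N. l i (\<sigma> j) (P (f j))) * (\<Prod>j<N. x (f j)))"
    by (rule sum.swap)
  also have "\<dots> = (\<Sum>f \<in> PiE {..<N} (\<lambda>_. V). polar (\<lambda>j. P (f j)) * (\<Prod>j<N. x (f j)))"
    by (simp add: polar_def sum_distrib_right)
  finally show ?thesis .
qed

text \<open>The weights \<open>w f\<close> are nonnegative and, by \<open>sym\<close>, every
  \<open>v\<close> has the same weighted number of occurrences \<open>d v\<close>. Hence the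
  deviations of \<open>ln (x v)\<close> from their mean cancel in the weighted sum over all
  tuples.\<close>

lemma geometric_mean_le_form:
  assumes V: "finite V" "V \<noteq> {}"
    and P: "\<And>v c. v \<in> V \<Longrightarrow> c > 0 \<Longrightarrow> P v + c *\<^sub>R e \<in> C"
    and e: "(\<Sum>v\<in>V. P v) = e"
    and sym: "\<And>u v t. u \<in> V \<Longrightarrow> v \<in> V \<Longrightarrow>
      (\<Sum>i<k. \<Prod>j<N. l i j (e + t *\<^sub>R P u)) = (\<Sum>i<k. \<Prod>j<N. l i j (e + t *\<^sub>R P v))"
    and x: "\<And>v. v \<in> V \<Longrightarrow> x v > 0"
  shows "(\<Sum>i<k. \<Prod>j<N. l i j e) * ((\<Prod>v\<in>V. x v) powr (1 / card V)) ^ N \<le>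
    (\<Sum>i<k. \<Prod>j<N. l i j (\<Sum>v\<in>V. x v *\<^sub>R P v))"
proof -
  define E where "E = PiE {..<N} (\<lambda>_. V)"
  define w where "w f = polar (\<lambda>j. P (f j))" for f
  define d where "d v = (\<Sum>f\<in>E. w f * (\<Sum>j<N. of_bool (f j = v)))" for v
  define \<mu> where "\<mu> = (\<Sum>v\<in>V. ln (x v)) / card V"
  have E: "f j \<in> V" if "f \<in> E" "j < N" for f j
    using that by (auto simp: E_def)
  have w: "w f \<ge> 0" if "f \<in> E" for f
    unfolding w_def using E[OF that] P by (intro polar_nonneg) auto
  have expand: "fact N * (\<Sum>i<k. \<Prod>j<N. l i j (\<Sum>v\<in>V. x v *\<^sub>R P v)) = (\<Sum>f\<in>E. w f * (\<Prod>j<N. x (f j)))" for x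
    unfolding w_def E_def by (rule form_expansion[OF V(1)])
  have deriv: "((\<lambda>t. fact N * (\<Sum>i<k. \<Prod>j<N. l i j (e + t *\<^sub>R P v))) has_real_derivative d v) (at 0)"
    if v: "v \<in> V" for v
  proof -
    \<comment> \<open>\<open>fact N\<close> times the form at \<open>e + t P v\<close>, read off the
      expansion with \<open>x v = 1 + t\<close> and all other eigenvalues equal to
      \<open>1\<close>.\<close>
    define q where "q = (\<Sum>f\<in>E. smult (w f) (\<Prod>j<N. [:1, of_bool (f j = v):]))"
    have "e + t *\<^sub>R P v = (\<Sum>u\<in>V. (1 + t * of_bool (u = v)) *\<^sub>R P u)" for t
      using V v e by (simp add: scaleR_add_left sum.distrib of_bool_def if_distrib[where f = "\<lambda>c. (t * c) *\<^sub>R _"] cong: if_cong)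
    then have "(\<lambda>t. fact N * (\<Sum>i<k. \<Prod>j<N. l i j (e + t *\<^sub>R P v))) = poly q"
      by (simp add: expand q_def poly_sum_prod_linear fun_eq_iff)
    moreover have "poly (pderiv q) 0 = d v"
    proof -
      have pderiv_sum: "pderiv (\<Sum>f\<in>E. g f) = (\<Sum>f\<in>E. pderiv (g f))" for g :: "_ \<Rightarrow> real poly"
        by (induction E rule: infinite_finite_induct) (auto simp: pderiv_add)
      show ?thesis
        by (simp add: q_def d_def pderiv_sum pderiv_smult pderiv_prod poly_sum poly_prod pderiv_pCons)
    qed
    ultimately show ?thesis using poly_DERIV[of q 0] by simp
  qed
  obtain v0 where v0: "v0 \<in> V" using V by blast
  have d_eq: "d v = d v0" if "v \<in> V" for v
    using deriv[OF that] deriv[OF v0] unfolding sym[OF that v0] by (rule DERIV_unique)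
  \<comment> \<open>Double counting: occurrences are grouped by the element of \<open>V\<close> that
    fills the slot.\<close>
  have linear_sum: "(\<Sum>f\<in>E. w f * (\<Sum>j<N. y (f j))) = d v0 * (\<Sum>v\<in>V. y v)" for y :: "_ \<Rightarrow> real"
  proof -
    have "(\<Sum>f\<in>E. w f * (\<Sum>j<N. y (f j))) = (\<Sum>f\<in>E. w f * (\<Sum>j<N. \<Sum>v\<in>V. y v * of_bool (f j = v)))"
    proof (intro sum.cong arg_cong2[where f = "(*)"] refl)
      fix f j assume "f \<in> E" "j \<in> {..<N}"
      then show "y (f j) = (\<Sum>v\<in>V. y v * of_bool (f j = v))"
        using E V by (simp add: of_bool_def if_distrib cong: if_cong)
    qed
    also have "\<dots> = (\<Sum>f\<in>E. \<Sum>v\<in>V. y v * (w f * (\<Sum>j<N. of_bool (f j = v))))"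
      by (subst sum.swap) (simp add: sum_distrib_left mult_ac)
    also have "\<dots> = (\<Sum>v\<in>V. y v * d v)"
      by (subst sum.swap) (simp add: d_def sum_distrib_left)
    also have "\<dots> = d v0 * (\<Sum>v\<in>V. y v)"
      by (simp add: d_eq sum_distrib_left mult.commute)
    finally show ?thesis .
  qed
  have card: "real (card V) > 0" using V by (simp add: card_gt_0_iff)
  have balance: "(\<Sum>f\<in>E. w f * (\<Sum>j<N. ln (x (f j)) - \<mu>)) = 0"
  proof -
    have "(\<Sum>v\<in>V. ln (x v) - \<mu>) = 0"
      unfolding sum_subtractf sum_constant using card by (simp add: \<mu>_def)
    then show ?thesis
      unfolding linear_sum[of "\<lambda>v. ln (x v) - \<mu>"] by simp
  qed
  have fe: "fact N * (\<Sum>i<k. \<Prod>j<N. l i j e) = (\<Sum>f\<in>E. w f)"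
    using expand[of "\<lambda>_. 1"] e by simp
  have gm: "(\<Prod>v\<in>V. x v) powr (1 / card V) = exp \<mu>"
  proof -
    have "(\<Prod>v\<in>V. x v) > 0" using x by (intro prod_pos) auto
    moreover have "ln (\<Prod>v\<in>V. x v) = (\<Sum>v\<in>V. ln (x v))"
      using V by (intro ln_prod) (auto dest: x)
    ultimately show ?thesis by (simp add: powr_def \<mu>_def)
  qed
  \<comment> \<open>Adding \<open>balance\<close>, which is zero, lets the comparison be made one
    tuple at a time, with tangency where all eigenvalues equal \<open>exp \<mu>\<close>.\<close>
  have "(\<Sum>f\<in>E. w f) * exp \<mu> ^ N = (\<Sum>f\<in>E. w f * (1 + (\<Sum>j<N. ln (x (f j)) - \<mu>))) * exp \<mu> ^ N"
    using balance by (simp add: distrib_left sum.distrib)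
  also have "\<dots> = (\<Sum>f\<in>E. w f * ((1 + (\<Sum>j<N. ln (x (f j)) - \<mu>)) * exp \<mu> ^ N))"
    by (simp add: sum_distrib_right mult.assoc)
  also have "\<dots> \<le> (\<Sum>f\<in>E. w f * (\<Prod>j<N. x (f j)))"
  proof (intro sum_mono mult_left_mono w)
    fix f assume f: "f \<in> E"
    have "(1 + (\<Sum>j<N. ln (x (f j)) - \<mu>)) * exp \<mu> ^ N \<le> exp (\<Sum>j<N. ln (x (f j)) - \<mu>) * exp \<mu> ^ N"
      by (intro mult_right_mono exp_ge_add_one_self) simp
    also have "\<dots> = (\<Prod>j<N. exp (ln (x (f j)) - \<mu>) * exp \<mu>)"
      by (simp add: exp_sum prod.distrib)
    also have "\<dots> = (\<Prod>j<N. x (f j))"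
      using E[OF f] x by (intro prod.cong) (auto simp: exp_diff)
    finally show "(1 + (\<Sum>j<N. ln (x (f j)) - \<mu>)) * exp \<mu> ^ N \<le> (\<Prod>j<N. x (f j))" .
  qed
  finally have "fact N * ((\<Sum>i<k. \<Prod>j<N. l i j e) * exp \<mu> ^ N) \<le>
      fact N * (\<Sum>i<k. \<Prod>j<N. l i j (\<Sum>v\<in>V. x v *\<^sub>R P v))"
    unfolding expand fe[symmetric] by (simp add: mult.assoc)
  then show ?thesis
    unfolding gm by simp
qed

end


section \<open>Hermitian matrices over the reals, complex numbers and quaternions\<close>

lemma inner_matrix_vector_mult: "(A *v x) \<bullet> y = x \<bullet> (transpose A *v y)" for A :: "real^'m^'n"
  by (metis dot_lmul_matrix transpose_matrix_vector transpose_transpose)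

lemma uminus_matrix_vector_mult: "(- A) *v x = - (A *v x)" for A :: "real^'m^'n"
  by (metis diff_0 matrix_vector_mult_0 matrix_vector_mult_diff_rdistrib)

lemma matrix_mult_uminus_right: "A ** (- B) = - (A ** B)" for A :: "real^'m^'n"
  by (simp add: matrix_matrix_mult_def vec_eq_iff sum_negf)

lemma matrix_mult_uminus_left: "(- A) ** B = - (A ** B)" for A :: "real^'m^'n"
  by (simp add: matrix_matrix_mult_def vec_eq_iff sum_negf)

lemma sum_matrix_vector_mult: "(\<Sum>i\<in>I. A i) *v x = (\<Sum>i\<in>I. A i *v x)" for A :: "'i \<Rightarrow> real^'m^'n"
  by (induction I rule: infinite_finite_induct) (auto simp: matrix_vector_mult_add_rdistrib)

text \<open>Serves as the first-order condition at the maximiser of the Rayleigh quotient.\<close>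

lemma quadratic_nonneg_imp_linear_zero:
  fixes b c :: real
  assumes "\<And>t. 0 \<le> 2 * t * b + t\<^sup>2 * c"
  shows "b = 0"
proof (rule ccontr)
  assume "b \<noteq> 0"
  \<comment> \<open>The minimiser when \<open>c\<close> is replaced by the larger
    \<open>1 + \<bar>c\<bar>\<close>, which is positive even for \<open>c = 0\<close>.\<close>
  define t where "t = - b / (1 + \<bar>c\<bar>)"
  have "2 * t * b + t\<^sup>2 * c \<le> 2 * t * b + t\<^sup>2 * (1 + \<bar>c\<bar>)"
    by (intro add_left_mono mult_left_mono) auto
  also have "t\<^sup>2 * (1 + \<bar>c\<bar>) = - t * b"
    by (simp add: t_def power2_eq_square)
  also have "2 * t * b + - t * b = - (b\<^sup>2 / (1 + \<bar>c\<bar>))"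
    by (simp add: t_def power2_eq_square)
  also have "\<dots> < 0" using \<open>b \<noteq> 0\<close> by (simp add: add_pos_nonneg)
  finally show False using assms[of t] by simp
qed

text \<open>The eigenvector maximises the Rayleigh quotient on the invariant subspace.\<close>

lemma exists_eigenvector_in_subspace:
  fixes A :: "real^'m^'m"
  assumes sym: "transpose A = A" and W: "subspace W" and inv: "\<And>x. x \<in> W \<Longrightarrow> A *v x \<in> W"
    and "w \<in> W" "w \<noteq> 0"
  obtains v c where "v \<in> W" "v \<bullet> v = 1" "A *v v = c *\<^sub>R v"
proof -
  define K where "K = W \<inter> sphere 0 1"
  have "compact K"
    unfolding K_def using closed_subspace[OF W] by (simp add: closed_Int_compact)
  moreover have "w /\<^sub>R norm w \<in> K"
    using assms by (simp add: K_def subspace_scale)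
  moreover have "continuous_on K (\<lambda>x. x \<bullet> (A *v x))"
    by (intro continuous_intros matrix_vector_mult_linear_continuous_on)
  ultimately obtain v where v: "v \<in> K" and max: "\<And>x. x \<in> K \<Longrightarrow> x \<bullet> (A *v x) \<le> v \<bullet> (A *v v)"
    using continuous_attains_sup[of K] by blast
  define c where "c = v \<bullet> (A *v v)"
  have vW: "v \<in> W" and vv: "v \<bullet> v = 1"
    using v by (auto simp: K_def norm_eq_1)
  have le: "x \<bullet> (A *v x) \<le> c * (x \<bullet> x)" if x: "x \<in> W" for x
  proof (cases "x = 0")
    case False
    then have "x /\<^sub>R norm x \<in> K" using x W by (simp add: K_def subspace_scale)
    from max[OF this] have "(x \<bullet> (A *v x)) / (norm x)\<^sup>2 \<le> c"
      by (simp add: c_def matrix_vector_mult_scaleR power2_eq_square divide_inverse mult_ac)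
    then show ?thesis using False by (simp add: divide_le_eq dot_square_norm)
  qed simp
  \<comment> \<open>Comparing \<open>v\<close> with \<open>v + t z\<close> gives a quadratic in
    \<open>t\<close> without constant term. The residual \<open>c v - A v\<close> lies in
    \<open>W\<close> by invariance, so it is orthogonal to itself.\<close>
  have "(c *\<^sub>R v - A *v v) \<bullet> z = 0" if z: "z \<in> W" for z
  proof (rule quadratic_nonneg_imp_linear_zero)
    fix t
    have "v + t *\<^sub>R z \<in> W" using vW z W by (simp add: subspace_add subspace_scale)
    from le[OF this] have "(v + t *\<^sub>R z) \<bullet> (A *v (v + t *\<^sub>R z)) \<le> c * ((v + t *\<^sub>R z) \<bullet> (v + t *\<^sub>R z))" .
    moreover have "v \<bullet> (A *v z) = z \<bullet> (A *v v)"
      by (metis inner_matrix_vector_mult inner_commute sym)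
    ultimately show "0 \<le> 2 * t * ((c *\<^sub>R v - A *v v) \<bullet> z) + t\<^sup>2 * (c * (z \<bullet> z) - z \<bullet> (A *v z))"
      using vv by (simp add: c_def[symmetric] matrix_vector_right_distrib matrix_vector_mult_scaleR inner_add_left inner_add_right
          inner_diff_left inner_commute[of "A *v v" z] inner_commute[of z v] algebra_simps power2_eq_square)
  qed
  moreover have "c *\<^sub>R v - A *v v \<in> W"
    using vW W inv by (simp add: subspace_diff subspace_scale)
  ultimately have "A *v v = c *\<^sub>R v" by fastforce
  then show ?thesis using that vW vv by blast
qed

text \<open>By compactness the quadratic form has a positive minimum on the unit sphere, and
  removing half of it keeps the inequality strict. This supplies \<open>C_open\<close> for the
  cone.\<close>

lemma pos_def_minus_scaled_identity:
  fixes A :: "real^'m^'m::finite"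
  assumes "pos_def A"
  shows "\<exists>c>0. pos_def (A - c *\<^sub>R mat 1)"
proof -
  have "continuous_on (sphere 0 1) (\<lambda>x. x \<bullet> (A *v x))"
    by (intro continuous_intros matrix_vector_mult_linear_continuous_on)
  moreover have "sphere (0 :: real^'m) 1 \<noteq> {}" by simp
  ultimately obtain u where u: "u \<in> sphere 0 1" and min: "\<And>x. x \<in> sphere 0 1 \<Longrightarrow> u \<bullet> (A *v u) \<le> x \<bullet> (A *v x)"
    using continuous_attains_inf[OF compact_sphere, of 0 1 "\<lambda>x. x \<bullet> (A *v x)"] by blast
  define m where "m = u \<bullet> (A *v u)"
  have "u \<noteq> 0" using u by auto
  then have "m > 0" using assms by (simp add: m_def pos_def_def)
  have "x \<bullet> ((A - (m / 2) *\<^sub>R mat 1) *v x) > 0" if "x \<noteq> 0" for x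
  proof -
    have "x /\<^sub>R norm x \<in> sphere 0 1" using that by simp
    from min[OF this] have "m \<le> (x \<bullet> (A *v x)) / (norm x)\<^sup>2"
      by (simp add: m_def matrix_vector_mult_scaleR power2_eq_square divide_inverse mult_ac)
    then have "m * (x \<bullet> x) \<le> x \<bullet> (A *v x)"
      using that by (simp add: le_divide_eq dot_square_norm)
    moreover have "m * (x \<bullet> x) > 0" using \<open>m > 0\<close> that by simp
    ultimately show ?thesis
      by (simp add: matrix_vector_mult_diff_rdistrib inner_diff_right flip: scaleR_matrix_vector_assoc)
  qed
  then show ?thesis using \<open>m > 0\<close> by (intro exI[of _ "m / 2"]) (simp add: pos_def_def)
qed

text \<open>A set \<open>T\<close> of orthogonal matrices representing, up to sign, the units of \<open>\<real>\<close>, \<open>\<complex>\<close> or the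
  quaternions; it makes \<open>real^'m\<close> a module over that algebra.\<close>

locale unit_system =
  fixes T :: "(real^'m^'m::finite) set"
  assumes finite_T: "finite T"
    and one_in_T: "mat 1 \<in> T"
    and orth: "\<And>t. t \<in> T \<Longrightarrow> orthogonal_matrix t"
    and closed: "\<And>s t. s \<in> T \<Longrightarrow> t \<in> T \<Longrightarrow> transpose s ** t \<in> T \<or> - (transpose s ** t) \<in> T"
    and perp: "\<And>s t x. s \<in> T \<Longrightarrow> t \<in> T \<Longrightarrow> s \<noteq> t \<Longrightarrow> (s *v x) \<bullet> (t *v x) = 0"
begin

definition herm :: "(real^'m^'m) set" where
  "herm = {A. transpose A = A \<and> (\<forall>t\<in>T. A ** t = t ** A)}"

lemma herm_iff:
  "A \<in> herm \<longleftrightarrow> transpose A = A \<and> (\<forall>t\<in>T. \<forall>x. A *v (t *v x) = t *v (A *v x))"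
  by (simp add: herm_def matrix_eq[of "A ** _"] flip: matrix_vector_mul_assoc)

text \<open>For a unit vector \<open>v\<close> the vectors \<open>t *v v\<close> are orthonormal,
  and this is the orthogonal projection onto their span, the line of \<open>v\<close> over the
  algebra.\<close>

definition Kproj :: "real^'m \<Rightarrow> real^'m^'m" where
  "Kproj v = (\<chi> i j. \<Sum>t\<in>T. (t *v v) $ i * (t *v v) $ j)"

lemma Kproj_apply: "Kproj v *v x = (\<Sum>t\<in>T. ((t *v v) \<bullet> x) *\<^sub>R (t *v v))"
  by (simp add: vec_eq_iff matrix_vector_mult_def Kproj_def inner_vec_def sum_distrib_left sum_distrib_right mult_ac
      del: matrix_vector_mul_component) (subst sum.swap, simp add: mult_ac)

lemma inner_Kproj: "x \<bullet> (Kproj v *v x) = (\<Sum>t\<in>T. ((t *v v) \<bullet> x)\<^sup>2)"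
  by (simp add: Kproj_apply inner_sum_right power2_eq_square inner_commute)

lemma transpose_Kproj [simp]: "transpose (Kproj v) = Kproj v"
  by (simp add: transpose_def Kproj_def vec_eq_iff mult.commute)

lemma orth_mult: "t \<in> T \<Longrightarrow> transpose t ** t = mat 1" "t \<in> T \<Longrightarrow> t ** transpose t = mat 1"
  using orth by (auto simp: orthogonal_matrix_def)

lemma inner_orth: "t \<in> T \<Longrightarrow> (t *v x) \<bullet> (t *v y) = x \<bullet> y"
  by (simp add: inner_matrix_vector_mult matrix_vector_mul_assoc orth_mult del: transpose_matrix_vector)

text \<open>Orthogonality of distinct units \<open>s\<close> and \<open>- s\<close> would force
  \<open>s *v x = 0\<close>. Consequently a matrix that lies in \<open>T\<close> up to sign has only
  one representative there.\<close>

lemma uminus_notin_T: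
  assumes "s \<in> T" shows "- s \<notin> T"
proof
  assume "- s \<in> T"
  let ?x = "axis undefined 1 :: real^'m"
  have "?x \<bullet> ?x = (s *v ?x) \<bullet> (s *v ?x)" using assms by (simp add: inner_orth)
  moreover have "s \<noteq> - s"
  proof
    assume "s = - s"
    then have "s = 0" by (metis add_eq_0_iff scaleR_2 scaleR_eq_0_iff zero_neq_numeral)
    then show False using inner_orth[OF assms, of ?x ?x] by (simp add: inner_axis_axis)
  qed
  ultimately show False
    using perp[OF assms \<open>- s \<in> T\<close>, of ?x] by (simp add: uminus_matrix_vector_mult inner_axis_axis)
qed

text \<open>Left multiplication by \<open>g\<^sup>T\<close> permutes \<open>T\<close> up to sign, and \<open>Kproj\<close> does not see the signs.\<close>

lemma sum_T_left_mult:
  assumes g: "g \<in> T" and even: "\<And>s. f (- s) = f s"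
  shows "(\<Sum>t\<in>T. f (transpose g ** t)) = (\<Sum>t\<in>T. f t)"
proof -
  define p where "p t = (if transpose g ** t \<in> T then transpose g ** t else - (transpose g ** t))" for t
  have p: "p t \<in> T" if "t \<in> T" for t
    using closed[OF g that] by (auto simp: p_def)
  have "inj_on p T"
  proof
    fix s t assume st: "s \<in> T" "t \<in> T" "p s = p t"
    then have "transpose g ** s = transpose g ** t \<or> transpose g ** s = - (transpose g ** t)"
      by (auto simp: p_def split: if_splits) (metis minus_minus)+
    then have "g ** (transpose g ** s) = g ** (transpose g ** t) \<or> g ** (transpose g ** s) = g ** (- (transpose g ** t))"
      by auto
    then have "s = t \<or> s = - t"
      using g by (simp add: matrix_mult_uminus_right matrix_mul_assoc orth_mult)
    then show "s = t" using uminus_notin_T st by auto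
  qed
  moreover have "p ` T = T"
    using \<open>inj_on p T\<close> p finite_T by (intro endo_inj_surj) auto
  ultimately have "(\<Sum>t\<in>T. f t) = (\<Sum>t\<in>T. f (p t))"
    using sum.reindex[of p T f] by simp
  also have "\<dots> = (\<Sum>t\<in>T. f (transpose g ** t))"
    by (intro sum.cong) (auto simp: p_def even)
  finally show ?thesis by simp
qed

text \<open>Writing \<open>t = g ** (transpose g ** t)\<close> brings \<open>g\<close> in front of
  the sum, and the sum over \<open>transpose g ** t\<close> is one over \<open>T\<close> because its
  summand is even in the unit.\<close>

lemma Kproj_in_herm: "Kproj v \<in> herm"
proof -
  have "Kproj v *v (g *v x) = g *v (Kproj v *v x)" if g: "g \<in> T" for g x
  proof -
    have "(t *v v) \<bullet> (g *v x) = ((transpose g ** t) *v v) \<bullet> x" for t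
      using inner_matrix_vector_mult[of g x "t *v v"]
      by (simp add: inner_commute del: transpose_matrix_vector flip: matrix_vector_mul_assoc)
    moreover have "g *v ((transpose g ** t) *v v) = t *v v" for t
      using g by (simp add: matrix_vector_mul_assoc matrix_mul_assoc orth_mult)
    ultimately have "Kproj v *v (g *v x) = (\<Sum>t\<in>T. (((transpose g ** t) *v v) \<bullet> x) *\<^sub>R (g *v ((transpose g ** t) *v v)))"
      by (simp add: Kproj_apply)
    also have "\<dots> = (\<Sum>t\<in>T. ((t *v v) \<bullet> x) *\<^sub>R (g *v (t *v v)))"
      by (rule sum_T_left_mult[OF g, where f = "\<lambda>s. ((s *v v) \<bullet> x) *\<^sub>R (g *v (s *v v))"])
        (simp add: uminus_matrix_vector_mult linear_neg)
    also have "\<dots> = g *v (Kproj v *v x)"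
      by (simp add: Kproj_apply linear_sum[OF matrix_vector_mul_linear] matrix_vector_mult_scaleR)
    finally show ?thesis .
  qed
  then show ?thesis by (simp add: herm_iff)
qed

lemma herm_commute: "A \<in> herm \<Longrightarrow> t \<in> T \<Longrightarrow> A *v (t *v x) = t *v (A *v x)"
  by (simp add: herm_def matrix_vector_mul_assoc)

lemma subspace_herm: "subspace herm"
proof -
  have "transpose (A + B) = transpose A + transpose B" "transpose (0 :: real^'m^'m) = 0" for A B :: "real^'m^'m"
    by (simp_all add: transpose_def vec_eq_iff)
  then show ?thesis
    by (auto simp: subspace_def herm_iff transpose_scalar matrix_vector_mult_add_rdistrib
        matrix_vector_right_distrib matrix_vector_mult_scaleR simp flip: scaleR_matrix_vector_assoc)
qed

lemma mat_1_in_herm: "mat 1 \<in> herm"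
  by (simp add: herm_def)

text \<open>Together with \<open>exists_swap\<close> this lets invariance compare perturbations of
  the identity along two eigenlines.\<close>

lemma Kproj_conjugate:
  assumes comm: "\<And>t. t \<in> T \<Longrightarrow> g ** t = t ** g"
  shows "g ** Kproj v ** transpose g = Kproj (g *v v)"
proof -
  have "(g *v (Kproj v *v (transpose g *v x))) = Kproj (g *v v) *v x" for x
  proof -
    have "g *v (t *v v) = t *v (g *v v)" if "t \<in> T" for t
      using comm[OF that] by (simp add: matrix_vector_mul_assoc)
    moreover have "(t *v v) \<bullet> (transpose g *v x) = (g *v (t *v v)) \<bullet> x" for t
      by (simp add: inner_matrix_vector_mult)
    ultimately show ?thesis
      by (simp add: Kproj_apply linear_sum[OF matrix_vector_mul_linear] matrix_vector_mult_scaleR del: transpose_matrix_vector)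
  qed
  then show ?thesis
    by (simp add: matrix_eq del: transpose_matrix_vector flip: matrix_vector_mul_assoc)
qed

section \<open>Orthonormal eigenbases over the algebra\<close>

text \<open>Orthonormality for the algebra-valued Hermitian product, whose real components are, up
  to sign, the numbers \<open>u \<bullet> (t *v v)\<close>.\<close>

definition Kortho :: "(real^'m) set \<Rightarrow> bool" where
  "Kortho V \<longleftrightarrow> (\<forall>v\<in>V. v \<bullet> v = 1) \<and> (\<forall>u\<in>V. \<forall>v\<in>V. u \<noteq> v \<longrightarrow> (\<forall>t\<in>T. u \<bullet> (t *v v) = 0))"

lemma inner_T_left:
  assumes "\<And>t. t \<in> T \<Longrightarrow> u \<bullet> (t *v v) = 0" "s \<in> T" "t \<in> T"
  shows "(s *v u) \<bullet> (t *v v) = 0"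
proof -
  have eq: "(s *v u) \<bullet> (t *v v) = u \<bullet> ((transpose s ** t) *v v)"
    by (simp add: inner_matrix_vector_mult matrix_vector_mul_assoc del: transpose_matrix_vector)
  show ?thesis
    using closed[OF assms(2,3)]
  proof
    assume "- (transpose s ** t) \<in> T"
    from assms(1)[OF this] show ?thesis by (simp add: eq uminus_matrix_vector_mult)
  qed (simp add: eq assms(1))
qed

lemma Kortho_inner:
  assumes "Kortho V" "u \<in> V" "v \<in> V" "s \<in> T" "t \<in> T"
  shows "(s *v u) \<bullet> (t *v v) = of_bool (u = v \<and> s = t)"
proof (cases "u = v")
  case True
  then show ?thesis using assms by (cases "s = t") (auto simp: inner_orth perp Kortho_def)
next
  case False
  then show ?thesis using assms by (simp add: inner_T_left Kortho_def)
qed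

lemma Kortho_inj:
  assumes V: "Kortho V"
  shows "inj_on (\<lambda>(t, v). t *v v) (T \<times> V)"
proof (rule inj_onI, clarify)
  fix s u t v assume *: "s \<in> T" "u \<in> V" "t \<in> T" "v \<in> V" "s *v u = t *v v"
  have "(s *v u) \<bullet> (s *v u) = 1" using Kortho_inner[OF V, of u u s s] * by simp
  then show "s = t \<and> u = v"
    using Kortho_inner[OF V, of u v s t] * by (auto split: if_splits)
qed

lemma Kortho_independent:
  assumes V: "Kortho V"
  shows "independent ((\<lambda>(t, v). t *v v) ` (T \<times> V))"
proof (rule pairwise_orthogonal_independent)
  show "pairwise orthogonal ((\<lambda>(t, v). t *v v) ` (T \<times> V))"
    using Kortho_inner[OF V] by (auto simp: pairwise_def orthogonal_def)
  show "0 \<notin> (\<lambda>(t, v). t *v v) ` (T \<times> V)"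
  proof clarify
    fix t v assume "0 = t *v v" "t \<in> T" "v \<in> V"
    then show False using Kortho_inner[OF V, of v v t t] by simp
  qed
qed

lemma card_T_pos: "card T > 0"
  using finite_T one_in_T by (auto simp: card_gt_0_iff)

lemma Kortho_finite:
  assumes V: "Kortho V"
  shows "finite V" and "card T * card V \<le> CARD('m)"
proof -
  have fin: "finite ((\<lambda>(t, v). t *v v) ` (T \<times> V))"
    and le: "card ((\<lambda>(t, v). t *v v) ` (T \<times> V)) \<le> CARD('m)"
    using independent_bound[OF Kortho_independent[OF V]] by auto
  have "finite (T \<times> V)"
    using fin Kortho_inj[OF V] by (rule finite_imageD)
  then show "finite V" using one_in_T by (auto dest: finite_cartesian_productD2)
  show "card T * card V \<le> CARD('m)"
    using le by (simp add: card_image[OF Kortho_inj[OF V]] card_cartesian_product)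
qed

text \<open>A family of orthonormal eigenvectors of greatest size is complete: its orthogonal
  complement over the algebra is invariant under \<open>A\<close>, because \<open>A\<close> is
  symmetric and commutes with \<open>T\<close>, so a nonzero complement would contribute a further
  eigenvector.\<close>

lemma exists_Kortho_eigenbasis:
  assumes A: "A \<in> herm"
  obtains V c where "Kortho V" "\<And>v. v \<in> V \<Longrightarrow> A *v v = c v *\<^sub>R v"
    "\<And>x. (\<And>t v. t \<in> T \<Longrightarrow> v \<in> V \<Longrightarrow> (t *v v) \<bullet> x = 0) \<Longrightarrow> x = 0"
proof -
  define good where "good V \<longleftrightarrow> Kortho V \<and> (\<forall>v\<in>V. \<exists>c. A *v v = c *\<^sub>R v)" for V
  have "good {}" by (simp add: good_def Kortho_def)
  moreover have "\<forall>V. good V \<longrightarrow> card V < Suc (CARD('m))"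
  proof (intro allI impI)
    fix V assume "good V"
    then have "card T * card V \<le> CARD('m)" by (simp add: good_def Kortho_finite)
    moreover have "card V \<le> card T * card V" using card_T_pos by simp
    ultimately show "card V < Suc (CARD('m))" by linarith
  qed
  ultimately obtain V where V: "good V" and max: "\<And>V'. good V' \<Longrightarrow> card V' \<le> card V"
    using ex_has_greatest_nat[of good "{}" card] by metis
  have KV: "Kortho V" using V by (simp add: good_def)
  obtain c where c: "\<And>v. v \<in> V \<Longrightarrow> A *v v = c v *\<^sub>R v"
    using V unfolding good_def by metis
  have "x = 0" if x: "\<And>t v. t \<in> T \<Longrightarrow> v \<in> V \<Longrightarrow> (t *v v) \<bullet> x = 0" for x
  proof (rule ccontr)
    assume "x \<noteq> 0"
    define W where "W = {x. \<forall>t\<in>T. \<forall>v\<in>V. x \<bullet> (t *v v) = 0}"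
    have "subspace W" by (auto simp: W_def subspace_def inner_add_left)
    moreover have "A *v y \<in> W" if "y \<in> W" for y
      using that A by (auto simp: W_def inner_matrix_vector_mult herm_def matrix_vector_mult_scaleR
          herm_commute[OF A] c simp del: transpose_matrix_vector)
    moreover have "x \<in> W" using x by (simp add: W_def inner_commute)
    ultimately obtain v d where v: "v \<in> W" "v \<bullet> v = 1" "A *v v = d *\<^sub>R v"
      using exists_eigenvector_in_subspace[of A W x] A \<open>x \<noteq> 0\<close> by (auto simp: herm_def)
    have "v \<notin> V"
      using v one_in_T by (auto simp: W_def)
    \<comment> \<open>\<open>Kortho\<close> asks for both orders; the second follows because moving
      \<open>t\<close> across the inner product stays within \<open>T\<close> up to sign.\<close>
    have perp': "v \<bullet> (t *v u) = 0" "u \<bullet> (t *v v) = 0" if "u \<in> V" "t \<in> T" for u t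
    proof -
      have *: "v \<bullet> (t *v u) = 0" if "t \<in> T" for t
        using v(1) that \<open>u \<in> V\<close> by (simp add: W_def)
      then show "v \<bullet> (t *v u) = 0" using that by simp
      show "u \<bullet> (t *v v) = 0"
        using inner_T_left[of v u t "mat 1"] * that one_in_T by (simp add: inner_commute)
    qed
    have "good (insert v V)"
      using V v perp' by (auto simp: good_def Kortho_def)
    then have "card (insert v V) \<le> card V" by (rule max)
    then show False using Kortho_finite[OF KV] \<open>v \<notin> V\<close> by simp
  qed
  then show ?thesis using that KV c by blast
qed

definition Kcomplete :: "(real^'m) set \<Rightarrow> bool" where
  "Kcomplete V \<longleftrightarrow> Kortho V \<and> (\<forall>x. (\<forall>t\<in>T. \<forall>v\<in>V. (t *v v) \<bullet> x = 0) \<longrightarrow> x = 0)"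

lemma Kproj_Kortho:
  assumes "Kortho V" "u \<in> V" "v \<in> V" "t \<in> T"
  shows "Kproj u *v (t *v v) = of_bool (u = v) *\<^sub>R (t *v v)"
proof -
  have "Kproj u *v (t *v v) = (\<Sum>s\<in>T. of_bool (u = v \<and> s = t) *\<^sub>R (s *v u))"
    unfolding Kproj_apply using assms by (intro sum.cong) (auto simp: Kortho_inner)
  also have "\<dots> = of_bool (u = v) *\<^sub>R (t *v v)"
    using finite_T assms by (cases "u = v") (simp_all add: of_bool_def if_distrib[where f = "\<lambda>c. c *\<^sub>R _"] cong: if_cong)
  finally show ?thesis .
qed

text \<open>What is left of \<open>x\<close> after subtracting its projections is orthogonal to
  every \<open>t *v v\<close>, so completeness makes it zero.\<close>

lemma sum_Kproj:
  assumes V: "Kcomplete V"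
  shows "(\<Sum>v\<in>V. Kproj v) = mat 1"
proof -
  have KV: "Kortho V" and fin: "finite V"
    using V Kortho_finite by (auto simp: Kcomplete_def)
  have "x - (\<Sum>v\<in>V. Kproj v *v x) = 0" for x
  proof -
    have "(t *v v) \<bullet> (x - (\<Sum>u\<in>V. Kproj u *v x)) = 0" if "t \<in> T" "v \<in> V" for t v
    proof -
      have "(t *v v) \<bullet> (\<Sum>u\<in>V. Kproj u *v x) = (\<Sum>u\<in>V. (Kproj u *v (t *v v)) \<bullet> x)"
        by (simp add: inner_sum_right inner_matrix_vector_mult del: transpose_matrix_vector)
      also have "\<dots> = (\<Sum>u\<in>V. of_bool (u = v) * ((t *v v) \<bullet> x))"
        using that KV by (intro sum.cong) (auto simp: Kproj_Kortho)
      also have "\<dots> = (t *v v) \<bullet> x"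
        using fin that by (simp add: of_bool_def if_distrib[where f = "\<lambda>c. c * _"] cong: if_cong)
      finally show ?thesis by (simp add: inner_diff_right)
    qed
    then show ?thesis using V unfolding Kcomplete_def by blast
  qed
  then show ?thesis by (simp add: matrix_eq sum_matrix_vector_mult)
qed

text \<open>Since \<open>A\<close> commutes with \<open>T\<close>, the whole line of
  \<open>v\<close> over the algebra has the eigenvalue \<open>c v\<close>.\<close>

lemma eigenbasis_expansion:
  assumes A: "A \<in> herm" and V: "Kcomplete V" and c: "\<And>v. v \<in> V \<Longrightarrow> A *v v = c v *\<^sub>R v"
  shows "A = (\<Sum>v\<in>V. c v *\<^sub>R Kproj v)"
proof -
  have "A *v x = (\<Sum>v\<in>V. c v *\<^sub>R (Kproj v *v x))" for x
  proof -
    have "A *v x = A *v ((\<Sum>v\<in>V. Kproj v) *v x)" by (simp add: sum_Kproj[OF V])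
    also have "\<dots> = (\<Sum>v\<in>V. A *v (Kproj v *v x))"
      by (simp add: sum_matrix_vector_mult linear_sum[OF matrix_vector_mul_linear])
    also have "\<dots> = (\<Sum>v\<in>V. c v *\<^sub>R (Kproj v *v x))"
      by (intro sum.cong) (simp_all add: Kproj_apply linear_sum[OF matrix_vector_mul_linear] matrix_vector_mult_scaleR
        herm_commute[OF A] c scaleR_sum_right mult.commute)
    finally show ?thesis .
  qed
  then show ?thesis
    by (simp add: matrix_eq sum_matrix_vector_mult flip: scaleR_matrix_vector_assoc)
qed

text \<open>Symmetry of \<open>A\<close> kills the components of an eigenvector along lines with a
  different eigenvalue. Each remaining line contributes \<open>card T\<close> real dimensions, so
  the division in \<open>Kdet\<close> is exact.\<close>

lemma dim_eigenspace:
  assumes A: "A \<in> herm" and V: "Kcomplete V" and c: "\<And>v. v \<in> V \<Longrightarrow> A *v v = c v *\<^sub>R v"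
  shows "dim {x. A *v x = a *\<^sub>R x} = card T * card {v \<in> V. c v = a}"
proof -
  define V' where "V' = {v \<in> V. c v = a}"
  define B where "B = (\<lambda>(t, v). t *v v) ` (T \<times> V')"
  have KV: "Kortho V" using V by (simp add: Kcomplete_def)
  then have KV': "Kortho V'" by (auto simp: Kortho_def V'_def)
  have "card B = dim {x. A *v x = a *\<^sub>R x}"
  proof (rule basis_card_eq_dim)
    show "B \<subseteq> {x. A *v x = a *\<^sub>R x}"
      by (auto simp: B_def V'_def herm_commute[OF A] c matrix_vector_mult_scaleR)
    show "independent B" unfolding B_def by (rule Kortho_independent[OF KV'])
    show "{x. A *v x = a *\<^sub>R x} \<subseteq> span B"
    proof clarify
      fix x assume x: "A *v x = a *\<^sub>R x"
      have zero: "(t *v v) \<bullet> x = 0" if "t \<in> T" "v \<in> V" "c v \<noteq> a" for t v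
      proof -
        have "c v * ((t *v v) \<bullet> x) = (A *v (t *v v)) \<bullet> x"
          using that by (simp add: herm_commute[OF A] c matrix_vector_mult_scaleR)
        also have "\<dots> = a * ((t *v v) \<bullet> x)"
          using A x by (simp add: inner_matrix_vector_mult herm_def del: transpose_matrix_vector)
        finally show ?thesis using that by simp
      qed
      have "x = (\<Sum>v\<in>V. Kproj v *v x)"
        using sum_Kproj[OF V] by (metis matrix_vector_mul_lid sum_matrix_vector_mult)
      also have "\<dots> = (\<Sum>v\<in>V. \<Sum>t\<in>T. ((t *v v) \<bullet> x) *\<^sub>R (t *v v))"
        by (simp add: Kproj_apply)
      also have "\<dots> \<in> span B"
      proof (intro span_sum)
        fix v t assume vt: "v \<in> V" "t \<in> T"
        show "((t *v v) \<bullet> x) *\<^sub>R (t *v v) \<in> span B"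
        proof (cases "c v = a")
          case True
          then have "t *v v \<in> B" using vt by (force simp: B_def V'_def)
          then show ?thesis by (intro span_scale span_base)
        next
          case False
          then show ?thesis using zero vt by (simp add: span_zero)
        qed
      qed
      finally show "x \<in> span B" .
    qed
  qed
  moreover have "card B = card T * card V'"
    by (simp add: B_def card_image[OF Kortho_inj[OF KV']] card_cartesian_product)
  ultimately show ?thesis by (simp add: V'_def)
qed

text \<open>The eigenspace of the identity for \<open>1\<close> is the whole space.\<close>

lemma card_Kcomplete:
  assumes "Kcomplete V"
  shows "CARD('m) = card T * card V"
  using dim_eigenspace[OF mat_1_in_herm assms, of "\<lambda>_. 1" 1] by (simp add: dim_UNIV)

lemma Kdet_eq_prod:
  assumes A: "A \<in> herm" and V: "Kcomplete V" and c: "\<And>v. v \<in> V \<Longrightarrow> A *v v = c v *\<^sub>R v"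
  shows "Kdet (card T) A = (\<Prod>v\<in>V. c v)"
proof -
  have KV: "Kortho V" and fin: "finite V"
    using V Kortho_finite by (auto simp: Kcomplete_def)
  have ev: "{a. \<exists>x. x \<noteq> 0 \<and> A *v x = a *\<^sub>R x} = c ` V"
  proof (intro equalityI subsetI)
    fix a assume "a \<in> {a. \<exists>x. x \<noteq> 0 \<and> A *v x = a *\<^sub>R x}"
    then obtain x where x: "x \<noteq> 0" "A *v x = a *\<^sub>R x" by blast
    then have "\<not> {x. A *v x = a *\<^sub>R x} \<subseteq> {0}" by auto
    then have "dim {x. A *v x = a *\<^sub>R x} \<noteq> 0" by simp
    then have "{v \<in> V. c v = a} \<noteq> {}"
      using dim_eigenspace[OF A V c, of a] by (metis card.empty mult_0_right)
    then show "a \<in> c ` V" by auto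
  next
    fix a assume "a \<in> c ` V"
    then obtain v where v: "v \<in> V" "a = c v" by auto
    then have "v \<bullet> v = 1" using KV by (simp add: Kortho_def)
    then have "v \<noteq> 0" by auto
    then show "a \<in> {a. \<exists>x. x \<noteq> 0 \<and> A *v x = a *\<^sub>R x}" using c v by auto
  qed
  have "Kdet (card T) A = (\<Prod>a\<in>c ` V. a ^ card {v \<in> V. c v = a})"
    unfolding Kdet_def ev using dim_eigenspace[OF A V c] card_T_pos by simp
  also have "\<dots> = (\<Prod>a\<in>c ` V. \<Prod>v\<in>{v \<in> V. c v = a}. c v)"
    by (intro prod.cong) auto
  also have "\<dots> = (\<Prod>v\<in>V. c v)"
    using prod.image_gen[OF fin, of c c] by simp
  finally show ?thesis .
qed

text \<open>The reflection in the hyperplane over the algebra orthogonal to \<open>u - v\<close> swaps \<open>u\<close> and \<open>v\<close>.\<close>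

lemma exists_swap:
  assumes V: "Kortho V" and uv: "u \<in> V" "v \<in> V" "u \<noteq> v"
  obtains g where "orthogonal_matrix g" "\<And>t. t \<in> T \<Longrightarrow> g ** t = t ** g" "g *v u = v"
proof -
  \<comment> \<open>The factor normalises \<open>u - v\<close>, which has length
    \<open>sqrt 2\<close>.\<close>
  define w where "w = (1 / sqrt 2) *\<^sub>R (u - v)"
  define g where "g = mat 1 - 2 *\<^sub>R Kproj w"
  have "g \<in> herm"
    unfolding g_def by (intro subspace_diff[OF subspace_herm] subspace_scale[OF subspace_herm] mat_1_in_herm Kproj_in_herm)
  have in_uv: "(t *v u) \<bullet> u = of_bool (t = mat 1)" "(t *v v) \<bullet> u = 0" if "t \<in> T" for t
    using Kortho_inner[OF V, of u u t "mat 1"] Kortho_inner[OF V, of v u t "mat 1"] uv that one_in_T by auto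
  have "u \<bullet> u = 1" "v \<bullet> v = 1" "u \<bullet> v = 0" "v \<bullet> u = 0"
    using V uv in_uv[OF one_in_T] by (auto simp: Kortho_def inner_commute)
  then have "w \<bullet> w = 1"
    by (simp add: w_def inner_diff_left inner_diff_right field_simps)
  then have w: "Kortho {w}" by (simp add: Kortho_def)
  have idem: "Kproj w *v (Kproj w *v x) = Kproj w *v x" for x
    using Kproj_Kortho[OF w, of w w]
    by (simp add: Kproj_apply[of w x] linear_sum[OF matrix_vector_mul_linear] matrix_vector_mult_scaleR)
  have g_apply: "g *v x = x - 2 *\<^sub>R (Kproj w *v x)" for x
    by (simp add: g_def matrix_vector_mult_diff_rdistrib flip: scaleR_matrix_vector_assoc)
  have "Kproj w *v (g *v x) = - (Kproj w *v x)" for x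
    by (simp add: g_apply matrix_vector_mult_diff_distrib matrix_vector_mult_scaleR idem) (simp add: vec_eq_iff)
  then have "g *v (g *v x) = x" for x
    by (subst g_apply) (simp add: g_apply)
  then have "g ** g = mat 1"
    by (simp add: matrix_eq flip: matrix_vector_mul_assoc)
  then have "orthogonal_matrix g"
    using \<open>g \<in> herm\<close> by (simp add: orthogonal_matrix_def herm_def)
  moreover have "g *v u = v"
  proof -
    \<comment> \<open>Only \<open>t = mat 1\<close> survives: the other translates of
      \<open>u\<close>, and all translates of \<open>v\<close>, are orthogonal to
      \<open>u\<close>.\<close>
    have "Kproj w *v u = (\<Sum>t\<in>T. if t = mat 1 then (1 / sqrt 2) *\<^sub>R (t *v w) else 0)"
      unfolding Kproj_apply
      by (intro sum.cong) (auto simp: w_def matrix_vector_mult_scaleR matrix_vector_mult_diff_distrib inner_diff_left in_uv)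
    also have "\<dots> = (1 / sqrt 2) *\<^sub>R w"
      using finite_T one_in_T by simp
    also have "\<dots> = (1 / 2) *\<^sub>R (u - v)" by (simp add: w_def)
    finally show ?thesis
      by (simp add: g_apply)
  qed
  ultimately show ?thesis
    using that \<open>g \<in> herm\<close> by (simp add: herm_def)
qed

section \<open>The inequality, uniformly in the algebra\<close>

text \<open>Invariance is taken under the orthogonal matrices commuting with \<open>T\<close>, which
  form O(n), U(n) or Sp(n). They contain the swaps of \<open>exists_swap\<close>, so one argument
  serves all three algebras.\<close>

theorem determinant_majorization:
  fixes F :: "real^'m^'m \<Rightarrow> real" and N :: nat
  assumes "N > 0" and gd: "garding_dirichlet herm N F"
    and inv: "\<And>g A. orthogonal_matrix g \<Longrightarrow> (\<And>t. t \<in> T \<Longrightarrow> g ** t = t ** g) \<Longrightarrow> A \<in> herm \<Longrightarrow>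
      F (g ** A ** transpose g) = F A"
    and A: "A \<in> herm" "pos_def A"
  shows "F (mat 1) powr (1 / real N) * Kdet (card T) A powr (1 / (real CARD('m) / real (card T))) \<le> F A powr (1 / real N)"
proof -
  have "hom_poly_on herm N F"
    using gd by (simp add: garding_dirichlet_def)
  then obtain k and l :: "nat \<Rightarrow> nat \<Rightarrow> real^'m^'m \<Rightarrow> real"
    where "\<forall>i j. linear (l i j)" and "\<forall>x\<in>herm. F x = (\<Sum>i<k. \<Prod>j<N. l i j x)"
    unfolding hom_poly_on_def by auto
  then have lin: "\<And>i j. linear (l i j)" and F: "\<And>x. x \<in> herm \<Longrightarrow> F x = (\<Sum>i<k. \<Prod>j<N. l i j x)"
    by simp_all
  note l_simps = linear_add[OF lin] linear_scale[OF lin]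
  have F1: "F (mat 1) > 0"
    using gd by (simp add: garding_dirichlet_def)
  interpret hyperbolic_form herm "{A \<in> herm. pos_def A}" "mat 1" k N l
  proof (rule hyperbolic_form.intro)
    show "subspace herm" by (rule subspace_herm)
    show "linear (l i j)" for i j by (rule lin)
    show "mat 1 \<in> {A \<in> herm. pos_def A}" by (simp add: mat_1_in_herm pos_def_def)
    show "x + y \<in> {A \<in> herm. pos_def A}" if "x \<in> {A \<in> herm. pos_def A}" "y \<in> {A \<in> herm. pos_def A}" for x y
      using that subspace_add[OF subspace_herm] by (auto simp: pos_def_def matrix_vector_mult_add_rdistrib inner_add_right add_pos_pos)
    show "c *\<^sub>R x \<in> {A \<in> herm. pos_def A}" if "c > 0" "x \<in> {A \<in> herm. pos_def A}" for c x
      using that subspace_scale[OF subspace_herm] by (auto simp: pos_def_def simp flip: scaleR_matrix_vector_assoc)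
    show "\<exists>c>0. x - c *\<^sub>R mat 1 \<in> {A \<in> herm. pos_def A}" if "x \<in> {A \<in> herm. pos_def A}" for x
      using that pos_def_minus_scaled_identity[of x] subspace_diff[OF subspace_herm] subspace_scale[OF subspace_herm] mat_1_in_herm
      by blast
    show "(\<Sum>i<k. \<Prod>j<N. l i j (mat 1)) > 0" using F1 F mat_1_in_herm by simp
    show "(\<Sum>i<k. \<Prod>j<N. l i j x) \<noteq> 0" if "x \<in> {A \<in> herm. pos_def A}" for x
    proof -
      have "x \<in> garding_cone herm F" using gd that by (auto simp: garding_dirichlet_def)
      then have "F x \<noteq> 0" unfolding garding_cone_def using connected_component_subset by blast
      then show ?thesis using F that by simp
    qed
    show "z \<in> \<real>" if x: "x \<in> herm" and
      root: "(\<Sum>i<k. \<Prod>j<N. complex_of_real (l i j x) + z * complex_of_real (l i j (mat 1))) = 0" for x z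
    proof -
      obtain p :: "real poly" where p: "\<And>t. poly p t = F (t *\<^sub>R mat 1 + x)"
        and real: "\<And>z. poly (map_poly complex_of_real p) z = 0 \<Longrightarrow> z \<in> \<real>"
        using gd x unfolding garding_dirichlet_def by blast
      \<comment> \<open>The polynomial \<open>p\<close> is tied to \<open>F\<close> only at real
        arguments. Agreement at infinitely many points identifies its complexification with
        \<open>q\<close>, so the complex roots of \<open>q\<close> are real.\<close>
      define q where "q = (\<Sum>i<k. \<Prod>j<N. [:complex_of_real (l i j x), complex_of_real (l i j (mat 1)):])"
      have "poly (map_poly complex_of_real p) (of_real t) = poly q (of_real t)" for t
      proof -
        have "t *\<^sub>R mat 1 + x \<in> herm"
          using subspace_add[OF subspace_herm] subspace_scale[OF subspace_herm] mat_1_in_herm x by blast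
        then have "poly p t = (\<Sum>i<k. \<Prod>j<N. l i j x + t * l i j (mat 1))"
          by (simp add: p F l_simps add.commute)
        moreover have "poly (map_poly complex_of_real p) (of_real t) = of_real (poly p t)"
          by (induction p) (auto simp: map_poly_pCons)
        ultimately show ?thesis
          by (simp add: q_def poly_sum poly_prod)
      qed
      then have "range complex_of_real \<subseteq> {w. poly (map_poly complex_of_real p - q) w = 0}"
        by auto
      moreover have "infinite (range complex_of_real)"
        by (simp add: finite_image_iff inj_on_def infinite_UNIV_char_0)
      ultimately have "map_poly complex_of_real p - q = 0"
        using poly_roots_finite finite_subset by blast
      then have "poly (map_poly complex_of_real p) z = 0"
        using root by (simp add: q_def poly_sum poly_prod)
      then show ?thesis by (rule real)
    qed
  qed auto
  obtain V c where V: "Kcomplete V" and c: "\<And>v. v \<in> V \<Longrightarrow> A *v v = c v *\<^sub>R v"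
    using exists_Kortho_eigenbasis[OF A(1)] unfolding Kcomplete_def by metis
  have KV: "Kortho V" and fin: "finite V"
    using V Kortho_finite by (auto simp: Kcomplete_def)
  have card: "CARD('m) = card T * card V" by (rule card_Kcomplete[OF V])
  then have "V \<noteq> {}" by (metis card.empty mult_0_right zero_less_card_finite less_irrefl)
  have c_pos: "c v > 0" if "v \<in> V" for v
  proof -
    have "v \<bullet> v = 1" using KV that by (simp add: Kortho_def)
    moreover from this have "v \<noteq> 0" by auto
    ultimately show ?thesis using A(2) c[OF that] unfolding pos_def_def by force
  qed
  \<comment> \<open>Conjugation by the swap fixes the identity and carries \<open>Kproj u\<close> to
    \<open>Kproj v\<close>.\<close>
  have Fsym: "F (mat 1 + t *\<^sub>R Kproj u) = F (mat 1 + t *\<^sub>R Kproj v)" if uv: "u \<in> V" "v \<in> V" for u v t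
  proof (cases "u = v")
    case False
    then obtain g where g: "orthogonal_matrix g" "\<And>t. t \<in> T \<Longrightarrow> g ** t = t ** g" "g *v u = v"
      using exists_swap[OF KV uv] by blast
    have "g ** (mat 1 + t *\<^sub>R Kproj u) ** transpose g = g ** transpose g + t *\<^sub>R (g ** Kproj u ** transpose g)"
      by (simp add: matrix_eq matrix_vector_mult_add_rdistrib matrix_vector_right_distrib matrix_vector_mult_scaleR
          del: transpose_matrix_vector flip: matrix_vector_mul_assoc scaleR_matrix_vector_assoc)
    also have "\<dots> = mat 1 + t *\<^sub>R Kproj v"
      using g by (simp add: Kproj_conjugate orthogonal_matrix_def)
    finally show ?thesis
      using inv[OF g(1,2), of "mat 1 + t *\<^sub>R Kproj u"] subspace_add[OF subspace_herm] subspace_scale[OF subspace_herm]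
        mat_1_in_herm Kproj_in_herm by simp
  qed simp
  have in_herm: "mat 1 + t *\<^sub>R Kproj v \<in> herm" for t v
    using subspace_add[OF subspace_herm] subspace_scale[OF subspace_herm] mat_1_in_herm Kproj_in_herm by blast
  define \<gamma> where "\<gamma> = (\<Prod>v\<in>V. c v) powr (1 / card V)"
  have "(\<Prod>v\<in>V. c v) > 0" using c_pos by (intro prod_pos) auto
  then have "\<gamma> > 0" by (simp add: \<gamma>_def)
  have "F (mat 1) * \<gamma> ^ N \<le> (\<Sum>i<k. \<Prod>j<N. l i j (\<Sum>v\<in>V. c v *\<^sub>R Kproj v))"
    unfolding F[OF mat_1_in_herm] \<gamma>_def
  proof (rule geometric_mean_le_form[OF fin \<open>V \<noteq> {}\<close>])
    fix v and d :: real assume "d > 0"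
    then have "pos_def (Kproj v + d *\<^sub>R mat 1)"
      by (auto simp: pos_def_def matrix_vector_mult_add_rdistrib inner_add_right inner_Kproj sum_nonneg add_nonneg_pos
          simp flip: scaleR_matrix_vector_assoc)
    moreover have "Kproj v + d *\<^sub>R mat 1 \<in> herm"
      using subspace_add[OF subspace_herm] subspace_scale[OF subspace_herm] mat_1_in_herm Kproj_in_herm by blast
    ultimately show "Kproj v + d *\<^sub>R mat 1 \<in> {A \<in> herm. pos_def A}" by simp
  next
    fix u v t assume "u \<in> V" "v \<in> V"
    then show "(\<Sum>i<k. \<Prod>j<N. l i j (mat 1 + t *\<^sub>R Kproj u)) = (\<Sum>i<k. \<Prod>j<N. l i j (mat 1 + t *\<^sub>R Kproj v))"
      using Fsym F[OF in_herm] by metis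
  qed (use c_pos sum_Kproj[OF V] in auto)
  also have "\<dots> = F A"
    using eigenbasis_expansion[OF A(1) V c] F[OF A(1)] by simp
  finally have "(F (mat 1) * \<gamma> ^ N) powr (1 / real N) \<le> F A powr (1 / real N)"
    using F1 \<open>\<gamma> > 0\<close> by (intro powr_mono2) auto
  also have "(F (mat 1) * \<gamma> ^ N) powr (1 / real N) = F (mat 1) powr (1 / real N) * \<gamma>"
  proof -
    have "(\<gamma> ^ N) powr (1 / real N) = \<gamma>"
      using \<open>\<gamma> > 0\<close> \<open>N > 0\<close> by (simp add: powr_powr flip: powr_realpow)
    then show ?thesis using F1 \<open>\<gamma> > 0\<close> by (simp add: powr_mult)
  qed
  \<comment> \<open>By \<open>card\<close> the number of eigenlines is
    \<open>CARD('m) / card T\<close>, the matrix size over the algebra.\<close>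
  also have "\<gamma> = Kdet (card T) A powr (1 / (real CARD('m) / real (card T)))"
    using card card_T_pos by (simp add: \<gamma>_def Kdet_eq_prod[OF A(1) V c])
  finally show ?thesis .
qed

end

section \<open>The unit systems of the three algebras\<close>

lemma unit_system_real: "unit_system {mat 1 :: real^'m^'m::finite}"
  by unfold_locales (auto simp: orthogonal_matrix_def)

text \<open>Both sides are inverse to \<open>X\<close>.\<close>

lemma complex_structure_transpose:
  assumes "complex_structure X"
  shows "transpose X = - X"
proof -
  have orth: "transpose X ** X = mat 1" and sq: "X ** X = - mat 1"
    using assms by (auto simp: complex_structure_def orthogonal_matrix_def)
  have "transpose X ** (X ** X) = X" by (simp add: orth matrix_mul_assoc)
  then have "- transpose X = X" by (simp add: sq matrix_mult_uminus_right)
  then show ?thesis by (metis minus_minus)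
qed

lemma complex_structure_inner:
  assumes "complex_structure X"
  shows "(X *v x) \<bullet> x = 0" "x \<bullet> (X *v x) = 0"
proof -
  have "(X *v x) \<bullet> x = - ((X *v x) \<bullet> x)"
    using inner_matrix_vector_mult[of X x x] complex_structure_transpose[OF assms]
    by (simp add: uminus_matrix_vector_mult inner_commute del: transpose_matrix_vector)
  then show "(X *v x) \<bullet> x = 0" by simp
  then show "x \<bullet> (X *v x) = 0" by (simp add: inner_commute)
qed

lemma unit_system_complex:
  assumes J: "complex_structure J"
  shows "unit_system {mat 1, J}"
proof
  show "orthogonal_matrix t" if "t \<in> {mat 1, J}" for t
    using that J by (auto simp: complex_structure_def orthogonal_matrix_def)
  show "transpose s ** t \<in> {mat 1, J} \<or> - (transpose s ** t) \<in> {mat 1, J}" if "s \<in> {mat 1, J}" "t \<in> {mat 1, J}" for s t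
    using that J by (auto simp: complex_structure_transpose complex_structure_def matrix_mult_uminus_left)
  show "(s *v x) \<bullet> (t *v x) = 0" if "s \<in> {mat 1, J}" "t \<in> {mat 1, J}" "s \<noteq> t" for s t x
    using that J by (auto simp: complex_structure_inner)
qed auto

text \<open>Anticommutation is forced by \<open>K = I ** J\<close> squaring to minus the identity:
  this gives \<open>I ** (J ** K) = - mat 1\<close>, and cancelling units yields the rest of the
  table.\<close>

lemma quaternionic_structure_mult:
  assumes "quaternionic_structure I J K"
  shows "I ** I = - mat 1" "J ** J = - mat 1" "K ** K = - mat 1"
    "I ** J = K" "J ** K = I" "K ** I = J" "J ** I = - K" "K ** J = - I" "I ** K = - J"
proof -
  show II: "I ** I = - mat 1" and JJ: "J ** J = - mat 1" and KK: "K ** K = - mat 1" and IJ: "I ** J = K"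
    using assms by (auto simp: quaternionic_structure_def complex_structure_def)
  note neg = matrix_mult_uminus_left matrix_mult_uminus_right
  show KJ: "K ** J = - I" by (simp add: IJ[symmetric] JJ neg flip: matrix_mul_assoc)
  show IK: "I ** K = - J" by (simp add: IJ[symmetric] II neg matrix_mul_assoc)
  have "J ** K = - (I ** (I ** (J ** K)))" by (simp add: II neg matrix_mul_assoc)
  also have "I ** (J ** K) = - mat 1" by (simp add: IJ KK matrix_mul_assoc)
  finally show JK: "J ** K = I" by (simp add: neg)
  have "K ** I = - (K ** I ** J ** J)" by (simp add: JJ neg flip: matrix_mul_assoc)
  also have "K ** I ** J = - mat 1" by (simp add: IJ KK flip: matrix_mul_assoc)
  finally show KI: "K ** I = J" by (simp add: neg)
  show "J ** I = - K" by (simp add: JK[symmetric] JJ neg matrix_mul_assoc)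
qed

lemma unit_system_quaternionic:
  assumes Q: "quaternionic_structure I J K"
  shows "unit_system {mat 1, I, J, K}" and "card {mat 1, I, J, K} = 4"
proof -
  have cs: "complex_structure I" "complex_structure J" "complex_structure K"
    using Q by (auto simp: quaternionic_structure_def)
  note mult = quaternionic_structure_mult[OF Q]
  note tr = cs[THEN complex_structure_transpose]
  \<comment> \<open>Moving \<open>X\<close> across leaves
    \<open>- (x \<bullet> ((X ** Y) *v x))\<close>, which vanishes because \<open>X ** Y\<close> is
    skew.\<close>
  have perp: "(X *v x) \<bullet> (Y *v x) = 0" if "complex_structure X" "complex_structure (X ** Y)" for X Y :: "real^'a^'a" and x
    using complex_structure_inner(2)[OF that(2), of x] complex_structure_transpose[OF that(1)]
    by (simp add: inner_matrix_vector_mult uminus_matrix_vector_mult del: transpose_matrix_vector flip: matrix_vector_mul_assoc)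
  have perps: "(I *v x) \<bullet> (J *v x) = 0" "(J *v x) \<bullet> (K *v x) = 0" "(K *v x) \<bullet> (I *v x) = 0"
    "(J *v x) \<bullet> (I *v x) = 0" "(K *v x) \<bullet> (J *v x) = 0" "(I *v x) \<bullet> (K *v x) = 0" for x
    using perp[of I J x] perp[of J K x] perp[of K I x] cs mult by (auto simp: inner_commute)
  show us: "unit_system {mat 1, I, J, K}"
  proof
    show "orthogonal_matrix t" if "t \<in> {mat 1, I, J, K}" for t
      using that cs by (auto simp: complex_structure_def orthogonal_matrix_def)
    show "transpose s ** t \<in> {mat 1, I, J, K} \<or> - (transpose s ** t) \<in> {mat 1, I, J, K}"
      if "s \<in> {mat 1, I, J, K}" "t \<in> {mat 1, I, J, K}" for s t
      using that by (auto simp: tr mult matrix_mult_uminus_left)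
    show "(s *v x) \<bullet> (t *v x) = 0" if "s \<in> {mat 1, I, J, K}" "t \<in> {mat 1, I, J, K}" "s \<noteq> t" for s t x
      using that by (auto simp: perps complex_structure_inner[OF cs(1)] complex_structure_inner[OF cs(2)] complex_structure_inner[OF cs(3)])
  qed auto
  \<comment> \<open>Equality would make every \<open>X *v x\<close> orthogonal to itself.
    Distinctness of the units makes \<open>card T\<close> equal to \<open>4\<close>, the divisor in
    \<open>Kdet 4\<close>.\<close>
  have ne: "X \<noteq> Y" if "orthogonal_matrix X" "\<And>x. (X *v x) \<bullet> (Y *v x) = 0" for X Y :: "real^'a^'a"
  proof
    assume "X = Y"
    then have "X *v x = 0" for x using that(2) by simp
    then have "transpose X ** X = 0" by (simp add: matrix_eq del: transpose_matrix_vector flip: matrix_vector_mul_assoc)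
    then have "(mat 1 :: real^'a^'a) $ undefined $ undefined = 0" using that(1) by (simp add: orthogonal_matrix_def)
    then show False by (simp add: mat_def)
  qed
  have "mat 1 \<noteq> I" "mat 1 \<noteq> J" "mat 1 \<noteq> K" "I \<noteq> J" "I \<noteq> K" "J \<noteq> K"
    using cs by (intro ne; simp add: complex_structure_inner perps orthogonal_matrix_id; simp add: complex_structure_def)+
  then show "card {mat 1, I, J, K} = 4" by simp
qed

theorem theorem4p5:
  fixes N :: nat
  assumes "N > 0"
  shows
   "(\<forall>F :: real^'n::finite^'n \<Rightarrow> real.
       garding_dirichlet (sym_space []) N F \<and>
       invariant_under {g. orthogonal_matrix g} (sym_space []) F \<longrightarrow>
       (\<forall>A\<in>sym_space []. pos_def A \<longrightarrow>
          F A powr (1 / real N) \<ge>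
          F (mat 1) powr (1 / real N) * Kdet 1 A powr (1 / real CARD('n))))
  \<and> (\<forall>(J :: real^'c::finite^'c) (F :: real^'c^'c \<Rightarrow> real).
       complex_structure J \<and>
       garding_dirichlet (sym_space [J]) N F \<and>
       invariant_under (unitary_group J) (sym_space [J]) F \<longrightarrow>
       (\<forall>A\<in>sym_space [J]. pos_def A \<longrightarrow>
          F A powr (1 / real N) \<ge>
          F (mat 1) powr (1 / real N) * Kdet 2 A powr (1 / (real CARD('c) / 2))))
  \<and> (\<forall>(I :: real^'h::finite^'h) J K (F :: real^'h^'h \<Rightarrow> real).
       quaternionic_structure I J K \<and>
       garding_dirichlet (sym_space [I, J, K]) N F \<and>
       invariant_under (sp_sp1_group I J K) (sym_space [I, J, K]) F \<longrightarrow>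
       (\<forall>A\<in>sym_space [I, J, K]. pos_def A \<longrightarrow>
          F A powr (1 / real N) \<ge>
          F (mat 1) powr (1 / real N) * Kdet 4 A powr (1 / (real CARD('h) / 4))))"
proof (intro conjI allI impI ballI; elim conjE)
  fix F :: "real^'n^'n \<Rightarrow> real" and A :: "real^'n^'n"
  assume gd: "garding_dirichlet (sym_space []) N F" and inv: "invariant_under {g. orthogonal_matrix g} (sym_space []) F"
    and A: "A \<in> sym_space []" "pos_def A"
  interpret unit_system "{mat 1 :: real^'n^'n}" by (rule unit_system_real)
  have herm: "sym_space [] = herm" by (auto simp: sym_space_def herm_def)
  show "F A powr (1 / real N) \<ge> F (mat 1) powr (1 / real N) * Kdet 1 A powr (1 / real CARD('n))"
    using determinant_majorization[OF assms, of F A] gd inv A unfolding herm by (auto simp: invariant_under_def)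
next
  fix J :: "real^'c^'c" and F A
  assume J: "complex_structure J" and gd: "garding_dirichlet (sym_space [J]) N F"
    and inv: "invariant_under (unitary_group J) (sym_space [J]) F"
    and A: "A \<in> sym_space [J]" "pos_def A"
  interpret unit_system "{mat 1, J}" by (rule unit_system_complex[OF J])
  have herm: "sym_space [J] = herm" by (auto simp: sym_space_def herm_def)
  \<comment> \<open>Distinctness gives \<open>card T = 2\<close>, to match
    \<open>Kdet 2\<close>.\<close>
  have "mat 1 \<noteq> J"
  proof
    assume "mat 1 = J"
    then have "mat 1 = - (mat 1 :: real^'c^'c)" using J by (auto simp: complex_structure_def)
    then have "(mat 1 :: real^'c^'c) $ undefined $ undefined = (- mat 1 :: real^'c^'c) $ undefined $ undefined"
      by (rule arg_cong[where f = "\<lambda>M. M $ undefined $ undefined"])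
    then show False by (simp add: mat_def)
  qed
  then have "card {mat 1, J} = 2" by simp
  then show "F A powr (1 / real N) \<ge> F (mat 1) powr (1 / real N) * Kdet 2 A powr (1 / (real CARD('c) / 2))"
    using determinant_majorization[OF assms, of F A] gd inv A unfolding herm
    by (auto simp: invariant_under_def unitary_group_def)
next
  fix I J K :: "real^'h^'h" and F A
  assume Q: "quaternionic_structure I J K" and gd: "garding_dirichlet (sym_space [I, J, K]) N F"
    and inv: "invariant_under (sp_sp1_group I J K) (sym_space [I, J, K]) F"
    and A: "A \<in> sym_space [I, J, K]" "pos_def A"
  interpret unit_system "{mat 1, I, J, K}" by (rule unit_system_quaternionic[OF Q])
  have herm: "sym_space [I, J, K] = herm" by (auto simp: sym_space_def herm_def)
  have "g \<in> sp_sp1_group I J K"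
    if "orthogonal_matrix g" "\<And>t. t \<in> {mat 1, I, J, K} \<Longrightarrow> g ** t = t ** g" for g
  proof -
    \<comment> \<open>The Sp(n) factor is \<open>g\<close> itself and the unit quaternion is
      \<open>1\<close>.\<close>
    have "g = g ** (1 *\<^sub>R mat 1 + 0 *\<^sub>R I + 0 *\<^sub>R J + 0 *\<^sub>R K)" by simp
    moreover have "(1::real)\<^sup>2 + 0\<^sup>2 + 0\<^sup>2 + 0\<^sup>2 = 1" by simp
    ultimately show ?thesis using that unfolding sp_sp1_group_def by blast
  qed
  then have "F (g ** B ** transpose g) = F B"
    if "orthogonal_matrix g" "\<And>t. t \<in> {mat 1, I, J, K} \<Longrightarrow> g ** t = t ** g" "B \<in> herm" for g B
    using inv that unfolding herm invariant_under_def by blast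
  then have "F (mat 1) powr (1 / real N) * Kdet (card {mat 1, I, J, K}) A powr
      (1 / (real CARD('h) / real (card {mat 1, I, J, K}))) \<le> F A powr (1 / real N)"
    using gd A unfolding herm by (intro determinant_majorization[OF assms]) auto
  then show "F A powr (1 / real N) \<ge> F (mat 1) powr (1 / real N) * Kdet 4 A powr (1 / (real CARD('h) / 4))"
    by (simp add: unit_system_quaternionic(2)[OF Q])
qed

end
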